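(* Let $k_1,k_2$ be two scalar-valued kernels on a set $\Lambda$, let $\mathcal{E}_1,\mathcal{E}_2$ be Hilbert spaces, and put $K_1=k_1I_{\mathcal{E}_1}$, $K_2=k_2I_{\mathcal{E}_2}$, and $K=K_1*K_2$, i.e. $K(\lambda,\mu)=K_1(\lambda,\mu)\otimes K_2(\lambda,\mu)=k_1(\lambda,\mu)k_2(\lambda,\mu)I_{\mathcal{E}_1\otimes\mathcal{E}_2}$. Suppose that: (1) the map $M^{K_1}_\varphi\mapsto M^{K}_{\varphi*I}$ from (the multiplication operators of) $\mathcal{M}(\mathcal{H}_{K_1})$ to (those of) $\mathcal{M}(\mathcal{H}_{K})$ preserves the operator norm, i.e. $\|M^{K}_{\varphi*I}\|=\|M^{K_1}_\varphi\|$ for every $\varphi\in\mathcal{M}(\mathcal{H}_{K_1})$; (2) $\mathcal{H}_{k_1}\cap\mathcal{H}_{k_2}$ is dense in $\mathcal{H}_{k_1}$. Let $\varphi\in\mathcal{M}(\mathcal{H}_{K_1})$. If $M^{K}_{\varphi*I}$ is an isometry on $\mathcal{H}_K$, then $\varphi$ is a constant isometry on each equivalence class of $\sim_{k_1}$; that is, for each equivalence class $C\subseteq\Lambda$ of $\sim_{k_1}$ there is an isometry $V_C\in\mathcal{B}(\mathcal{E}_1)$ with $\varphi(\lambda)=V_C$ for all $\lambda\in C$. In particular, if $k_1(\lambda,\mu)\neq 0$ for all $\lambda,\mu\in\Lambda$, then $\sim_{k_1}$ has a single equivalence class and $\varphi$ is a constant isometry.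
   Context: All Hilbert spaces are complex. For a Hilbert space $\mathcal{E}$, a function $K:\Lambda\times\Lambda\to\mathcal{B}(\mathcal{E})$ is a kernel if $\sum_{p,q=1}^m\langle K(x_p,x_q)\eta_q,\eta_p\rangle\ge 0$ for all $m\in\mathbb{N}$, $x_j\in\Lambda$, $\eta_j\in\mathcal{E}$. Then $\mathcal{H}_K$ denotes the reproducing kernel Hilbert space of $\mathcal{E}$-valued functions on $\Lambda$ in which $\{K(\cdot,\lambda)\eta:\lambda\in\Lambda,\eta\in\mathcal{E}\}$ is total and $\langle f(\lambda),\eta\rangle_{\mathcal{E}}=\langle f,K(\cdot,\lambda)\eta\rangle_{\mathcal{H}_K}$. A scalar-valued kernel is the case $\mathcal{E}=\mathbb{C}$. Standing assumption: kernels satisfy $K(\cdot,\lambda)\neq 0$ for all $\lambda\in\Lambda$ (this applies to $k_1$, $k_2$ and $K$). $\mathcal{M}(\mathcal{H}_K)$ is the set of multipliers of $\mathcal{H}_K$: functions $\psi:\Lambda\to\mathcal{B}(\mathcal{E})$ with $\psi f\in\mathcal{H}_K$ for all $f\in\mathcal{H}_K$, where $(\psi f)(\lambda)=\psi(\lambda)f(\lambda)$. The bounded operator $f\mapsto\psi f$ on $\mathcal{H}_K$ is denoted $M^K_\psi$. For $\varphi:\Lambda\to\mathcal{B}(\mathcal{E}_1)$, $\varphi*I:\Lambda\to\mathcal{B}(\mathcal{E}_1\otimes\mathcal{E}_2)$ is the function $(\varphi*I)(\lambda)=\varphi(\lambda)\otimes I_{\mathcal{E}_2}$; if $\varphi\in\mathcal{M}(\mathcal{H}_{K_1})$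 then $\varphi*I\in\mathcal{M}(\mathcal{H}_{K})$. The equivalence relation $\sim_{k_1}$ on $\Lambda$: $\lambda\sim_{k_1}\mu$ if there exist $m\in\mathbb{N}$ and $\lambda_1,\dots,\lambda_m\in\Lambda$ with $\lambda_1=\lambda$, $\lambda_m=\mu$ and $k_1(\lambda_j,\lambda_{j+1})\neq 0$ for $1\le j\le m-1$. *)

theory Defs
  imports "HOL-Analysis.Analysis" "HOL-Library.Function_Algebras"
begin

section \<open>Complex vector spaces and complex Hilbert spaces\<close>

class complex_vector = ab_group_add +
  fixes scaleC :: "complex \<Rightarrow> 'a \<Rightarrow> 'a" (infixr "*\<^sub>C" 75)
  assumes scaleC_add_right: "c *\<^sub>C (x + y) = c *\<^sub>C x + c *\<^sub>C y"
    and scaleC_add_left: "(c + d) *\<^sub>C x = c *\<^sub>C x + d *\<^sub>C x"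
    and scaleC_scaleC: "c *\<^sub>C (d *\<^sub>C x) = (c * d) *\<^sub>C x"
    and scaleC_one: "1 *\<^sub>C x = x"

global_interpretation complex_vector:
  vector_space "scaleC :: complex \<Rightarrow> 'a \<Rightarrow> 'a::complex_vector"
  by unfold_locales
    (simp_all add: scaleC_add_right scaleC_add_left scaleC_scaleC scaleC_one)

instantiation "fun" :: (type, complex_vector) complex_vector
begin

definition scaleC_fun_def: "c *\<^sub>C f = (\<lambda>x. c *\<^sub>C f x)"

instance
  by standard
    (simp_all add: scaleC_fun_def fun_eq_iff scaleC_add_right scaleC_add_left
      scaleC_scaleC scaleC_one)

end

text \<open>Inner products are linear in the first argument and conjugate linear in the second.\<close>

class complex_hilbert = complex_vector + banach +
  fixes cinner :: "'a \<Rightarrow> 'a \<Rightarrow> complex"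
  assumes scaleC_of_real: "complex_of_real r *\<^sub>C x = r *\<^sub>R x"
    and cinner_add_left: "cinner (x + y) z = cinner x z + cinner y z"
    and cinner_scaleC_left: "cinner (c *\<^sub>C x) y = c * cinner x y"
    and cinner_commute: "cinner x y = cnj (cinner y x)"
    and cinner_self: "cinner x x = complex_of_real ((norm x)\<^sup>2)"

instantiation complex :: complex_hilbert
begin

definition scaleC_complex_def: "c *\<^sub>C (z::complex) = c * z"
definition cinner_complex_def: "cinner z (w::complex) = z * cnj w"

instance
  by standard
    (simp_all add: scaleC_complex_def cinner_complex_def algebra_simps scaleR_conv_of_real
      complex_norm_square del: of_real_power)

end

text \<open>\<open>bounded_clinear T\<close> says that \<open>T\<close> belongs to \<open>\<B>(\<E>)\<close>.\<close>

definition bounded_clinear :: "('a::complex_hilbert \<Rightarrow> 'b::complex_hilbert) \<Rightarrow> bool" where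
  "bounded_clinear T \<longleftrightarrow> bounded_linear T \<and> (\<forall>c x. T (c *\<^sub>C x) = c *\<^sub>C T x)"

definition isometry :: "('a::complex_hilbert \<Rightarrow> 'a) \<Rightarrow> bool" where
  "isometry V \<longleftrightarrow> bounded_clinear V \<and> (\<forall>x. norm (V x) = norm x)"

text \<open>
  \<open>hilbert_tensor tens\<close>: the type \<open>'c\<close> together with the map \<open>tens\<close> is (a model of) the Hilbert
  space tensor product of \<open>'a\<close> and \<open>'b\<close>.  These properties determine it up to a unique unitary
  that respects elementary tensors.
\<close>

definition hilbert_tensor ::
  "('a::complex_hilbert \<Rightarrow> 'b::complex_hilbert \<Rightarrow> 'c::complex_hilbert) \<Rightarrow> bool" where
  "hilbert_tensor tens \<longleftrightarrow>
     (\<forall>a a' b. tens (a + a') b = tens a b + tens a' b) \<and>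
     (\<forall>a b b'. tens a (b + b') = tens a b + tens a b') \<and>
     (\<forall>c a b. tens (c *\<^sub>C a) b = c *\<^sub>C tens a b) \<and>
     (\<forall>c a b. tens a (c *\<^sub>C b) = c *\<^sub>C tens a b) \<and>
     (\<forall>a a' b b'. cinner (tens a b) (tens a' b') = cinner a a' * cinner b b') \<and>
     closure (complex_vector.span {tens a b | a b. True}) = UNIV"

text \<open>For bounded \<open>A\<close> and \<open>B\<close> such an operator exists, and it is unique because elementary
  tensors are total.\<close>

definition op_tensor ::
  "('a::complex_hilbert \<Rightarrow> 'b::complex_hilbert \<Rightarrow> 'c::complex_hilbert) \<Rightarrow>
    ('a \<Rightarrow> 'a) \<Rightarrow> ('b \<Rightarrow> 'b) \<Rightarrow> 'c \<Rightarrow> 'c" where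
  "op_tensor tens A B =
     (THE T. bounded_clinear T \<and> (\<forall>a b. T (tens a b) = tens (A a) (B b)))"

section \<open>Hilbert spaces carried by a subspace\<close>

record 'v inner_space =
  hcarrier :: "'v set"
  hinner :: "'v \<Rightarrow> 'v \<Rightarrow> complex"

definition hnorm :: "'v inner_space \<Rightarrow> 'v \<Rightarrow> real" where
  "hnorm H f = sqrt (Re (hinner H f f))"

definition hilbert_space :: "'v::complex_vector inner_space \<Rightarrow> bool" where
  "hilbert_space H \<longleftrightarrow>
     complex_vector.subspace (hcarrier H) \<and>
     (\<forall>f\<in>hcarrier H. \<forall>g\<in>hcarrier H. \<forall>h\<in>hcarrier H.
        hinner H (f + g) h = hinner H f h + hinner H g h) \<and>
     (\<forall>c. \<forall>f\<in>hcarrier H. \<forall>g\<in>hcarrier H. hinner H (c *\<^sub>C f) g = c * hinner H f g) \<and>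
     (\<forall>f\<in>hcarrier H. \<forall>g\<in>hcarrier H. hinner H f g = cnj (hinner H g f)) \<and>
     (\<forall>f\<in>hcarrier H. hinner H f f \<in> \<real>\<^sub>\<ge>\<^sub>0) \<and>
     (\<forall>f\<in>hcarrier H. hinner H f f = 0 \<longrightarrow> f = 0) \<and>
     (\<forall>X. (\<forall>n::nat. X n \<in> hcarrier H) \<and>
          (\<forall>e>0. \<exists>N. \<forall>m\<ge>N. \<forall>n\<ge>N. hnorm H (X m - X n) < e) \<longrightarrow>
          (\<exists>f\<in>hcarrier H. (\<lambda>n. hnorm H (X n - f)) \<longlonglongrightarrow> 0))"

definition dense_in :: "'v::complex_vector set \<Rightarrow> 'v inner_space \<Rightarrow> bool" where
  "dense_in D H \<longleftrightarrow>
     D \<subseteq> hcarrier H \<and> (\<forall>f\<in>hcarrier H. \<forall>e>0. \<exists>g\<in>D. hnorm H (f - g) < e)"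

definition op_norm :: "'v inner_space \<Rightarrow> ('v \<Rightarrow> 'v) \<Rightarrow> real" where
  "op_norm H T = Sup {hnorm H (T f) | f. f \<in> hcarrier H \<and> hnorm H f \<le> 1}"

definition isometry_on :: "'v inner_space \<Rightarrow> ('v \<Rightarrow> 'v) \<Rightarrow> bool" where
  "isometry_on H T \<longleftrightarrow> (\<forall>f\<in>hcarrier H. T f \<in> hcarrier H \<and> hnorm H (T f) = hnorm H f)"

section \<open>Kernels, reproducing kernel Hilbert spaces and multipliers\<close>

text \<open>
  The set \<open>\<Lambda>\<close> is the type \<open>'l\<close>; \<open>K x y\<close> is an operator on \<open>'e\<close>, so a kernel has type
  \<open>'l \<Rightarrow> 'l \<Rightarrow> 'e \<Rightarrow> 'e\<close>.
\<close>

definition kernel :: "('l \<Rightarrow> 'l \<Rightarrow> 'e::complex_hilbert \<Rightarrow> 'e) \<Rightarrow> bool" where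
  "kernel K \<longleftrightarrow>
     (\<forall>x y. bounded_clinear (K x y)) \<and>
     (\<forall>(m::nat) x \<eta>. (\<Sum>p<m. \<Sum>q<m. cinner (K (x p) (x q) (\<eta> q)) (\<eta> p)) \<in> \<real>\<^sub>\<ge>\<^sub>0)"

definition nonvanishing :: "('l \<Rightarrow> 'l \<Rightarrow> 'e::complex_hilbert \<Rightarrow> 'e) \<Rightarrow> bool" where
  "nonvanishing K \<longleftrightarrow> (\<forall>y. (\<lambda>x. K x y) \<noteq> 0)"

text \<open>
  \<open>times_id k\<close> is \<open>k I\<^sub>\<E>\<close>.  With \<open>\<E> = \<complex>\<close> it is the scalar function \<open>k\<close> itself, each value
  being viewed as an operator on \<open>\<complex>\<close>.
\<close>

definition times_id :: "('l \<Rightarrow> 'l \<Rightarrow> complex) \<Rightarrow> 'l \<Rightarrow> 'l \<Rightarrow> 'e::complex_hilbert \<Rightarrow> 'e" where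
  "times_id k x y \<eta> = k x y *\<^sub>C \<eta>"

abbreviation scalar_kernel :: "('l \<Rightarrow> 'l \<Rightarrow> complex) \<Rightarrow> 'l \<Rightarrow> 'l \<Rightarrow> complex \<Rightarrow> complex" where
  "scalar_kernel k \<equiv> times_id k"

text \<open>
  \<open>rkhs K H\<close> says that \<open>H\<close> is \<open>\<H>\<^sub>K\<close>; for a kernel \<open>K\<close> there is exactly one such carrier, with a
  unique inner product on it.
\<close>

definition rkhs ::
  "('l \<Rightarrow> 'l \<Rightarrow> 'e::complex_hilbert \<Rightarrow> 'e) \<Rightarrow> ('l \<Rightarrow> 'e) inner_space \<Rightarrow> bool" where
  "rkhs K H \<longleftrightarrow>
     hilbert_space H \<and>
     dense_in (complex_vector.span {(\<lambda>x. K x y \<eta>) | y \<eta>. True}) H \<and>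
     (\<forall>f\<in>hcarrier H. \<forall>y \<eta>. cinner (f y) \<eta> = hinner H f (\<lambda>x. K x y \<eta>))"

definition mult_op :: "('l \<Rightarrow> 'e \<Rightarrow> 'e) \<Rightarrow> ('l \<Rightarrow> 'e) \<Rightarrow> 'l \<Rightarrow> 'e" where
  "mult_op \<psi> f = (\<lambda>x. \<psi> x (f x))"

definition multipliers :: "('l \<Rightarrow> 'e::complex_hilbert) inner_space \<Rightarrow> ('l \<Rightarrow> 'e \<Rightarrow> 'e) set" where
  "multipliers H =
     {\<psi>. (\<forall>x. bounded_clinear (\<psi> x)) \<and> (\<forall>f\<in>hcarrier H. mult_op \<psi> f \<in> hcarrier H)}"

text \<open>\<open>K\<^sub>1 * K\<^sub>2\<close> and \<open>\<phi> * I\<close>, relative to the tensor product given by \<open>tens\<close>.\<close>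

definition kernel_prod ::
  "('a::complex_hilbert \<Rightarrow> 'b::complex_hilbert \<Rightarrow> 'c::complex_hilbert) \<Rightarrow>
    ('l \<Rightarrow> 'l \<Rightarrow> 'a \<Rightarrow> 'a) \<Rightarrow> ('l \<Rightarrow> 'l \<Rightarrow> 'b \<Rightarrow> 'b) \<Rightarrow> 'l \<Rightarrow> 'l \<Rightarrow> 'c \<Rightarrow> 'c" where
  "kernel_prod tens K1 K2 x y = op_tensor tens (K1 x y) (K2 x y)"

definition mult_tensor_id ::
  "('a::complex_hilbert \<Rightarrow> 'b::complex_hilbert \<Rightarrow> 'c::complex_hilbert) \<Rightarrow>
    ('l \<Rightarrow> 'a \<Rightarrow> 'a) \<Rightarrow> 'l \<Rightarrow> 'c \<Rightarrow> 'c" where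
  "mult_tensor_id tens \<phi> x = op_tensor tens (\<phi> x) (id :: 'b \<Rightarrow> 'b)"

definition kernel_rel :: "('l \<Rightarrow> 'l \<Rightarrow> complex) \<Rightarrow> ('l \<times> 'l) set" where
  "kernel_rel k =
     {(x, y). \<exists>(m::nat) s. m \<ge> 1 \<and> s 1 = x \<and> s m = y \<and>
        (\<forall>j. 1 \<le> j \<and> j \<le> m - 1 \<longrightarrow> k (s j) (s (j + 1)) \<noteq> 0)}"

end

(* HK is the image of HK1 (x) Hk2 (x) 'b under restriction to the diagonal, and this restriction is
   contractive.  Let T be the tensor of two kernel functions at l with the first factor
   multiplied by phi.  Since phi is contractive on HK1 and isometric on HK, restricting T to the
   diagonal preserves its norm, so T is orthogonal to all tensors that vanish on the diagonal.
   Testing against f a (x) g - g a (x) f with f and g in both scalar spaces, which are dense in Hk1,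
   shows k1(., l) phi(.) eta = k1(., l) phi(l) eta.  Hence phi z = phi l whenever k1 z l is nonzero,
   and comparing norms makes phi l isometric. *)

theory Submission
  imports Defs
begin

text \<open>As simplification rules these also turn the unapplied \<open>f + g\<close> and \<open>0\<close> into abstractions.\<close>

declare plus_fun_apply [simp del] zero_fun_apply [simp del]

section \<open>Hilbert spaces carried by a subspace\<close>

text \<open>Why restriction preserves the norm of T: a chain of inequalities closes up.
  Contractivity bounds T by the tensor of the two kernel functions; that tensor has the norm of a
  kernel function in \<open>HK\<close>, both being governed by \<open>k1 l l * k2 l l\<close>; the
  isometry carries this norm to the restriction of T, which is at most T again. Pairing T with a
  swapped tensor shows that the inner product of the image with f a, times \<open>cnj (g l)\<close>,
  is symmetric in f and g. So it is a multiple of \<open>cnj (f l)\<close>, and a kernel function in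
  place of f identifies the image. The obstacle is contractivity. It is known only through
  \<open>op_norm\<close>, a supremum of reals that is informative only for a bounded set, while
  \<open>multipliers\<close> contains no bound on the operator. Boundedness is therefore derived
  from the continuity of point evaluations by a Baire type argument. Orthogonality needs no
  completion of the tensor product: it comes from perturbing T along one finite sum, so a positive
  semidefinite form on lists is enough.\<close>

locale hilbert_carrier =
  fixes H :: "'v::complex_vector inner_space"
  assumes hilbert_space: "hilbert_space H"
begin

abbreviation S where "S \<equiv> hcarrier H"
abbreviation ip where "ip \<equiv> hinner H"
abbreviation N where "N \<equiv> hnorm H"

lemmas axioms = hilbert_space[unfolded hilbert_space_def]

lemma subspace: "complex_vector.subspace S"
  using axioms by (rule conjunct1)

lemma zero_mem [simp]: "0 \<in> S"
  using complex_vector.subspace_0[OF subspace] .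

lemma add_mem [simp]: "f \<in> S \<Longrightarrow> g \<in> S \<Longrightarrow> f + g \<in> S"
  using complex_vector.subspace_add[OF subspace] .

lemma scale_mem [simp]: "f \<in> S \<Longrightarrow> c *\<^sub>C f \<in> S"
  using complex_vector.subspace_scale[OF subspace] .

lemma diff_mem [simp]: "f \<in> S \<Longrightarrow> g \<in> S \<Longrightarrow> f - g \<in> S"
  using complex_vector.subspace_diff[OF subspace] .

lemma minus_mem [simp]: "f \<in> S \<Longrightarrow> - f \<in> S"
  using complex_vector.subspace_neg[OF subspace] .

lemma sum_mem [simp]: "(\<And>i. i \<in> I \<Longrightarrow> f i \<in> S) \<Longrightarrow> sum f I \<in> S"
  using complex_vector.subspace_sum[OF subspace] .

lemma ip_add_left: "f \<in> S \<Longrightarrow> g \<in> S \<Longrightarrow> h \<in> S \<Longrightarrow> ip (f + g) h = ip f h + ip g h"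
  using axioms[THEN conjunct2, THEN conjunct1] by simp

lemma ip_scale_left: "f \<in> S \<Longrightarrow> g \<in> S \<Longrightarrow> ip (c *\<^sub>C f) g = c * ip f g"
  using axioms[THEN conjunct2, THEN conjunct2, THEN conjunct1] by simp

lemma ip_commute: "f \<in> S \<Longrightarrow> g \<in> S \<Longrightarrow> ip f g = cnj (ip g f)"
  using axioms[THEN conjunct2, THEN conjunct2, THEN conjunct2, THEN conjunct1] by blast

lemma ip_add_right: "f \<in> S \<Longrightarrow> g \<in> S \<Longrightarrow> h \<in> S \<Longrightarrow> ip h (f + g) = ip h f + ip h g"
  by (metis add_mem complex_cnj_add ip_add_left ip_commute)

lemma ip_scale_right: "f \<in> S \<Longrightarrow> g \<in> S \<Longrightarrow> ip f (c *\<^sub>C g) = cnj c * ip f g"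
  by (metis complex_cnj_mult ip_commute ip_scale_left scale_mem)

lemma ip_zero_left [simp]: "f \<in> S \<Longrightarrow> ip 0 f = 0"
  using ip_scale_left[of 0 f 0] by simp

lemma ip_zero_right [simp]: "f \<in> S \<Longrightarrow> ip f 0 = 0"
  using ip_scale_right[of f 0 0] by simp

lemma ip_diff_left: "f \<in> S \<Longrightarrow> g \<in> S \<Longrightarrow> h \<in> S \<Longrightarrow> ip (f - g) h = ip f h - ip g h"
  using ip_add_left[of "f - g" g h] by simp

lemma ip_diff_right: "f \<in> S \<Longrightarrow> g \<in> S \<Longrightarrow> h \<in> S \<Longrightarrow> ip h (f - g) = ip h f - ip h g"
  using ip_add_right[of "f - g" g h] by simp

lemma ip_sum_left:
  "(\<And>i. i \<in> I \<Longrightarrow> f i \<in> S) \<Longrightarrow> h \<in> S \<Longrightarrow> ip (\<Sum>i\<in>I. f i) h = (\<Sum>i\<in>I. ip (f i) h)"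
  by (induction I rule: infinite_finite_induct) (simp_all add: ip_add_left)

lemma ip_sum_right:
  "(\<And>i. i \<in> I \<Longrightarrow> f i \<in> S) \<Longrightarrow> h \<in> S \<Longrightarrow> ip h (\<Sum>i\<in>I. f i) = (\<Sum>i\<in>I. ip h (f i))"
  by (induction I rule: infinite_finite_induct) (simp_all add: ip_add_right)

lemma Re_ip_self_nonneg [simp]: "f \<in> S \<Longrightarrow> 0 \<le> Re (ip f f)"
  using axioms[THEN conjunct2, THEN conjunct2, THEN conjunct2, THEN conjunct2, THEN conjunct1]
  by (simp add: complex_nonneg_Reals_iff)

lemma N_nonneg [simp]: "f \<in> S \<Longrightarrow> 0 \<le> N f"
  by (simp add: hnorm_def)

lemma N_square: "f \<in> S \<Longrightarrow> (N f)\<^sup>2 = Re (ip f f)"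
  by (simp add: hnorm_def)

lemma ip_self: "f \<in> S \<Longrightarrow> ip f f = complex_of_real ((N f)\<^sup>2)"
proof -
  assume f: "f \<in> S"
  have "Im (ip f f) = Im (cnj (ip f f))"
    using ip_commute[OF f f] by (rule arg_cong)
  thus ?thesis
    unfolding N_square[OF f] by (intro complex_eqI) simp_all
qed

lemma N_eq_0: "f \<in> S \<Longrightarrow> N f = 0 \<longleftrightarrow> f = 0"
proof -
  assume f: "f \<in> S"
  have "ip f f = 0 \<Longrightarrow> f = 0"
    using axioms[THEN conjunct2, THEN conjunct2, THEN conjunct2, THEN conjunct2, THEN conjunct2,
        THEN conjunct1] f by simp
  thus ?thesis
    unfolding ip_self[OF f] by (auto simp: hnorm_def)
qed

lemma N_zero [simp]: "N 0 = 0"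
  by (simp add: N_eq_0)

lemma N_scale: "f \<in> S \<Longrightarrow> N (c *\<^sub>C f) = cmod c * N f"
proof -
  assume f: "f \<in> S"
  have "ip (c *\<^sub>C f) (c *\<^sub>C f) = c * cnj c * ip f f"
    using f by (simp add: ip_scale_left ip_scale_right)
  also have "\<dots> = complex_of_real ((cmod c * N f)\<^sup>2)"
    unfolding ip_self[OF f] power_mult_distrib of_real_mult complex_norm_square ..
  finally have "(N (c *\<^sub>C f))\<^sup>2 = (cmod c * N f)\<^sup>2"
    unfolding N_square[OF scale_mem[OF f]] by (simp only: Re_complex_of_real)
  thus ?thesis
    using f by (simp add: power2_eq_iff_nonneg)
qed

lemma Re_ip_commute: "f \<in> S \<Longrightarrow> g \<in> S \<Longrightarrow> Re (ip f g) = Re (ip g f)"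
  by (subst ip_commute) simp_all

lemma N_add_square:
  "f \<in> S \<Longrightarrow> g \<in> S \<Longrightarrow> (N (f + g))\<^sup>2 = (N f)\<^sup>2 + 2 * Re (ip f g) + (N g)\<^sup>2"
  by (simp add: N_square ip_add_left ip_add_right Re_ip_commute[of g f])

lemma N_diff_square:
  "f \<in> S \<Longrightarrow> g \<in> S \<Longrightarrow> (N (f - g))\<^sup>2 = (N f)\<^sup>2 - 2 * Re (ip f g) + (N g)\<^sup>2"
  by (simp add: N_square ip_diff_left ip_diff_right Re_ip_commute[of g f])

lemma cauchy_schwarz:
  assumes f: "f \<in> S" and g: "g \<in> S"
  shows "cmod (ip f g) \<le> N f * N g"
proof (cases "N g = 0")
  case True
  thus ?thesis using f g by (simp add: N_eq_0)
next
  case False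
  define c where "c = ip f g / (N g)\<^sup>2"
  have "0 \<le> (N (f - c *\<^sub>C g))\<^sup>2" by simp
  also have "\<dots> = (N f)\<^sup>2 - 2 * Re (cnj c * ip f g) + (cmod c * N g)\<^sup>2"
    using f g by (simp add: N_diff_square ip_scale_right N_scale)
  also have "cnj c * ip f g = complex_of_real ((cmod (ip f g))\<^sup>2 / (N g)\<^sup>2)"
    using complex_norm_square[of "ip f g"] by (simp add: c_def mult.commute)
  also have "(cmod c * N g)\<^sup>2 = (cmod (ip f g))\<^sup>2 / (N g)\<^sup>2"
    using False g by (simp add: c_def norm_divide norm_mult power2_eq_square divide_simps)
  finally have "(cmod (ip f g))\<^sup>2 / (N g)\<^sup>2 \<le> (N f)\<^sup>2"
    by (simp del: of_real_divide of_real_power)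
  hence "(cmod (ip f g))\<^sup>2 \<le> (N f * N g)\<^sup>2"
    using False by (simp add: divide_simps power_mult_distrib)
  thus ?thesis using f g by (simp add: power2_le_iff_abs_le)
qed

lemma N_triangle:
  assumes f: "f \<in> S" and g: "g \<in> S"
  shows "N (f + g) \<le> N f + N g"
proof -
  have "Re (ip f g) \<le> N f * N g"
    using cauchy_schwarz[OF f g] complex_Re_le_cmod[of "ip f g"] by linarith
  hence "(N (f + g))\<^sup>2 \<le> (N f + N g)\<^sup>2"
    using f g by (simp add: N_add_square power2_sum)
  thus ?thesis using f g by (simp add: power2_le_iff_abs_le)
qed

lemma N_minus_commute: "f \<in> S \<Longrightarrow> g \<in> S \<Longrightarrow> N (f - g) = N (g - f)"
  using N_scale[of "g - f" "-1"] by simp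

lemma N_triangle_diff:
  assumes "f \<in> S" "g \<in> S" "h \<in> S"
  shows "N (f - h) \<le> N (f - g) + N (g - h)"
  using N_triangle[of "f - g" "g - h"] assms by simp

lemma N_triangle_abs:
  assumes "f \<in> S" "g \<in> S"
  shows "\<bar>N f - N g\<bar> \<le> N (f - g)"
  using N_triangle[of "f - g" g] N_triangle[of "g - f" f] assms N_minus_commute[of f g]
  by (simp add: abs_le_iff)

lemma complete:
  assumes "\<And>n. X n \<in> S" and "\<And>e. e > 0 \<Longrightarrow> \<exists>M. \<forall>m\<ge>M. \<forall>n\<ge>M. N (X m - X n) < e"
  obtains f where "f \<in> S" "(\<lambda>n. N (X n - f)) \<longlonglongrightarrow> 0"
  using axioms[THEN conjunct2, THEN conjunct2, THEN conjunct2, THEN conjunct2, THEN conjunct2,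
      THEN conjunct2, rule_format, of X] assms by blast

section \<open>Convergence in norm\<close>

lemma dense_in_sequence:
  assumes "dense_in D H" "f \<in> S"
  obtains X where "\<And>n. X n \<in> D" "\<And>n. X n \<in> S" "(\<lambda>n. N (X n - f)) \<longlonglongrightarrow> 0"
proof -
  have "\<forall>n. \<exists>g\<in>D. N (f - g) < inverse (real (Suc n))"
    using assms by (auto simp: dense_in_def)
  then obtain X where X: "\<And>n. X n \<in> D" "\<And>n. N (f - X n) < inverse (real (Suc n))"
    by metis
  have mem: "X n \<in> S" for n
    using X(1) assms by (auto simp: dense_in_def)
  have "(\<lambda>n. N (X n - f)) \<longlonglongrightarrow> 0"
  proof (rule tendsto_sandwich[OF _ _ tendsto_const LIMSEQ_inverse_real_of_nat])
    show "\<forall>\<^sub>F n in sequentially. 0 \<le> N (X n - f)"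
      using mem assms by simp
    show "\<forall>\<^sub>F n in sequentially. N (X n - f) \<le> inverse (real (Suc n))"
      using X(2) mem assms N_minus_commute[of f] by (auto intro!: always_eventually less_imp_le)
  qed
  with X mem that show ?thesis by blast
qed

lemma tendsto_N:
  assumes "\<And>n. X n \<in> S" "f \<in> S" "(\<lambda>n. N (X n - f)) \<longlonglongrightarrow> 0"
  shows "(\<lambda>n. N (X n)) \<longlonglongrightarrow> N f"
proof -
  have "(\<lambda>n. N (X n) - N f) \<longlonglongrightarrow> 0"
    by (rule Lim_null_comparison[OF always_eventually assms(3)])
      (use N_triangle_abs assms in auto)
  thus ?thesis by (simp add: LIM_zero_iff)
qed

lemma tendsto_ip_left:
  assumes "\<And>n. X n \<in> S" "f \<in> S" "(\<lambda>n. N (X n - f)) \<longlonglongrightarrow> 0" "g \<in> S"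
  shows "(\<lambda>n. ip (X n) g) \<longlonglongrightarrow> ip f g"
proof -
  have "(\<lambda>n. ip (X n) g - ip f g) \<longlonglongrightarrow> 0"
  proof (rule Lim_null_comparison)
    show "\<forall>\<^sub>F n in sequentially. norm (ip (X n) g - ip f g) \<le> N (X n - f) * N g"
      using cauchy_schwarz[of "X _ - f" g] assms
      by (intro always_eventually) (simp add: ip_diff_left)
    show "(\<lambda>n. N (X n - f) * N g) \<longlonglongrightarrow> 0"
      using tendsto_mult_right[OF assms(3), of "N g"] by simp
  qed
  thus ?thesis by (simp add: LIM_zero_iff)
qed

lemma tendsto_ip_right:
  assumes "\<And>n. X n \<in> S" "f \<in> S" "(\<lambda>n. N (X n - f)) \<longlonglongrightarrow> 0" "g \<in> S"
  shows "(\<lambda>n. ip g (X n)) \<longlonglongrightarrow> ip g f"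
  using tendsto_cnj[OF tendsto_ip_left[OF assms]] assms
  by (simp add: ip_commute[of g])

lemma limit_Cauchy:
  assumes "\<And>n. X n \<in> S" "f \<in> S" "(\<lambda>n. N (X n - f)) \<longlonglongrightarrow> 0" "e > 0"
  shows "\<exists>M. \<forall>m\<ge>M. \<forall>n\<ge>M. N (X m - X n) < e"
proof -
  obtain M where M: "\<And>n. n \<ge> M \<Longrightarrow> N (X n - f) < e / 2"
    using order_tendstoD(2)[OF assms(3), of "e / 2"] assms(4)
    by (auto simp: eventually_sequentially)
  have "N (X m - X n) < e" if "m \<ge> M" "n \<ge> M" for m n
    using M[OF that(1)] M[OF that(2)] N_triangle_diff[of "X m" f "X n"] N_minus_commute[of f "X n"]
      assms(1,2) by simp
  thus ?thesis by blast
qed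

text \<open>Gram-Schmidt: peel off the component along the last vector.  If that vector vanishes, the
  divisions below give \<open>0\<close>, as they should.\<close>

lemma gram_factorization:
  fixes g :: "nat \<Rightarrow> 'v"
  assumes "\<And>i. i < n \<Longrightarrow> g i \<in> S"
  shows "\<exists>u :: nat \<Rightarrow> nat \<Rightarrow> complex.
    \<forall>i<n. \<forall>j<n. ip (g i) (g j) = (\<Sum>k<n. u k i * cnj (u k j))"
  using assms
proof (induction n arbitrary: g)
  case 0
  show ?case by simp
next
  case (Suc n)
  define r where "r = N (g n)"
  define g' where "g' i = g i - (ip (g i) (g n) / r\<^sup>2) *\<^sub>C g n" for i
  have mem: "g i \<in> S" if "i \<le> n" for i
    using Suc.prems that by simp
  have "\<exists>u :: nat \<Rightarrow> nat \<Rightarrow> complex.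
      \<forall>i<n. \<forall>j<n. ip (g' i) (g' j) = (\<Sum>k<n. u k i * cnj (u k j))"
    by (rule Suc.IH) (simp add: g'_def mem)
  then obtain u :: "nat \<Rightarrow> nat \<Rightarrow> complex"
    where u: "\<And>i j. i < n \<Longrightarrow> j < n \<Longrightarrow> ip (g' i) (g' j) = (\<Sum>k<n. u k i * cnj (u k j))"
    by blast
  have r0: "ip (g i) (g n) = 0" if "i \<le> n" "r = 0" for i
    using that mem[of n] mem[of i] by (simp add: r_def N_eq_0)
  have main: "ip (g i) (g j) =
      ip (g' i) (g' j) + (ip (g i) (g n) / r) * cnj (ip (g j) (g n) / r)" if "i < n" "j < n" for i j
  proof (cases "r = 0")
    case True
    thus ?thesis using that r0[of i] r0[of j] by (simp add: g'_def)
  next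
    case False
    have gn: "ip (g n) (g n) = r\<^sup>2"
      using mem[of n] ip_self[of "g n"] by (simp add: r_def)
    have gnj: "ip (g n) (g j) = cnj (ip (g j) (g n))"
      using mem[of n] mem[of j] that by (intro ip_commute) simp_all
    have "ip (g' i) (g' j) = ip (g i) (g j) - cnj (ip (g j) (g n) / r\<^sup>2) * ip (g i) (g n)
        - ip (g i) (g n) / r\<^sup>2 * (ip (g n) (g j) - cnj (ip (g j) (g n) / r\<^sup>2) * ip (g n) (g n))"
      using mem[of i] mem[of j] mem[of n] that
      by (simp add: g'_def ip_diff_left ip_diff_right ip_scale_left ip_scale_right
          right_diff_distrib diff_divide_distrib)
    also have "\<dots> = ip (g i) (g j) - ip (g i) (g n) / r * cnj (ip (g j) (g n) / r)"
      unfolding gn gnj using False by (simp add: power2_eq_square)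
    finally show ?thesis by simp
  qed
  \<comment> \<open>The first \<open>n\<close> coordinates describe the residuals \<open>g'\<close>,
    the last one the component along the normalized \<open>g n\<close>; hence \<open>g n\<close>
    itself has the single coordinate \<open>r\<close>.\<close>
  define v where "v k i = (if k < n then if i < n then u k i else 0
      else if i < n then ip (g i) (g n) / r else complex_of_real r)" for k i
  have "ip (g i) (g j) = (\<Sum>k<Suc n. v k i * cnj (v k j))" if ij: "i < Suc n" "j < Suc n" for i j
  proof -
    have rr: "r * (ip (g l) (g n) / r) = ip (g l) (g n)" if "l \<le> n" for l
      using r0[OF that] by (cases "r = 0") simp_all
    have s: "(\<Sum>k<Suc n. v k i * cnj (v k j)) =
        (\<Sum>k<n. v k i * cnj (v k j)) + v n i * cnj (v n j)"
      by simp
    consider "i < n" "j < n" | "i = n" "j < n" | "i < n" "j = n" | "i = n" "j = n"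
      using ij by linarith
    thus ?thesis
    proof cases
      case 1
      have "(\<Sum>k<n. v k i * cnj (v k j)) = ip (g' i) (g' j)"
        unfolding u[OF 1] by (rule sum.cong) (use 1 in \<open>auto simp: v_def\<close>)
      thus ?thesis unfolding s main[OF 1] using 1 by (simp add: v_def)
    next
      case 2
      have "(\<Sum>k<n. v k i * cnj (v k j)) = 0"
        by (rule sum.neutral) (use 2 in \<open>auto simp: v_def\<close>)
      moreover have "ip (g n) (g j) = cnj (r * (ip (g j) (g n) / r))"
        unfolding rr[OF less_imp_le[OF 2(2)]]
        using mem[of n] mem[of j] 2 by (intro ip_commute) simp_all
      ultimately show ?thesis unfolding s using 2 by (simp add: v_def)
    next
      case 3
      have "(\<Sum>k<n. v k i * cnj (v k j)) = 0"
        by (rule sum.neutral) (use 3 in \<open>auto simp: v_def\<close>)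
      thus ?thesis
        unfolding s using 3 rr[OF less_imp_le[OF 3(1)]] by (simp add: v_def mult.commute)
    next
      case 4
      have "(\<Sum>k<n. v k i * cnj (v k j)) = 0"
        by (rule sum.neutral) (use 4 in \<open>auto simp: v_def\<close>)
      thus ?thesis
        unfolding s using 4 ip_self[of "g n"] mem[of n] by (simp add: v_def r_def power2_eq_square)
    qed
  qed
  thus ?case by blast
qed

text \<open>The Schur product argument. If \<open>v k i\<close> are coordinates of vectors b_i in an
  orthonormal system, the left side is the squared norm of the sum of f_i \<otimes> b_i, and the
  right side computes it coordinate by coordinate.\<close>

lemma gram_schur:
  assumes "\<And>i. i < (n::nat) \<Longrightarrow> f i \<in> S"
  shows "(\<Sum>i<n. \<Sum>j<n. ip (f i) (f j) * (\<Sum>k\<in>I. v k i * cnj (v k j))) =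
    complex_of_real (\<Sum>k\<in>I. (N (\<Sum>i<n. v k i *\<^sub>C f i))\<^sup>2)"
proof -
  have *: "complex_of_real ((N (\<Sum>i<n. v k i *\<^sub>C f i))\<^sup>2) =
      (\<Sum>i<n. \<Sum>j<n. ip (f i) (f j) * (v k i * cnj (v k j)))" for k
  proof -
    have mem: "(\<Sum>i<n. v k i *\<^sub>C f i) \<in> S"
      by (intro sum_mem scale_mem assms) simp
    have "complex_of_real ((N (\<Sum>i<n. v k i *\<^sub>C f i))\<^sup>2) =
        ip (\<Sum>i<n. v k i *\<^sub>C f i) (\<Sum>i<n. v k i *\<^sub>C f i)"
      by (rule ip_self[OF mem, symmetric])
    also have "\<dots> = (\<Sum>i<n. ip (v k i *\<^sub>C f i) (\<Sum>j<n. v k j *\<^sub>C f j))"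
      using assms mem by (intro ip_sum_left) simp_all
    also have "\<dots> = (\<Sum>i<n. \<Sum>j<n. ip (v k i *\<^sub>C f i) (v k j *\<^sub>C f j))"
      using assms by (intro sum.cong ip_sum_right) simp_all
    finally show ?thesis
      using assms by (simp add: ip_scale_left ip_scale_right mult_ac)
  qed
  have "(\<Sum>i<n. \<Sum>j<n. ip (f i) (f j) * (\<Sum>k\<in>I. v k i * cnj (v k j))) =
      (\<Sum>i<n. \<Sum>k\<in>I. \<Sum>j<n. ip (f i) (f j) * (v k i * cnj (v k j)))"
    by (intro sum.cong refl) (simp add: sum_distrib_left sum.swap[of _ I])
  also have "\<dots> = (\<Sum>k\<in>I. \<Sum>i<n. \<Sum>j<n. ip (f i) (f j) * (v k i * cnj (v k j)))"
    by (rule sum.swap)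
  also have "\<dots> = (\<Sum>k\<in>I. complex_of_real ((N (\<Sum>i<n. v k i *\<^sub>C f i))\<^sup>2))"
    by (simp only: *)
  finally show ?thesis by (simp only: of_real_sum)
qed

end

section \<open>Hilbert space types as carriers\<close>

lemma norm_eq_sqrt_cinner: "norm (x::'a::complex_hilbert) = sqrt (Re (cinner x x))"
  by (simp add: cinner_self del: of_real_power)

text \<open>Lets the same facts serve for inner products of functions and for those of their
  values.\<close>

global_interpretation hilbert_type:
  hilbert_carrier "\<lparr>hcarrier = UNIV, hinner = cinner\<rparr> :: 'a::complex_hilbert inner_space"
  rewrites "hcarrier \<lparr>hcarrier = UNIV, hinner = cinner\<rparr> = (UNIV :: 'a set)"
    and "hinner \<lparr>hcarrier = UNIV, hinner = cinner\<rparr> = (cinner :: 'a \<Rightarrow> 'a \<Rightarrow> complex)"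
    and "hnorm \<lparr>hcarrier = UNIV, hinner = cinner\<rparr> = (norm :: 'a \<Rightarrow> real)"
proof -
  let ?H = "\<lparr>hcarrier = UNIV, hinner = cinner\<rparr> :: 'a inner_space"
  show n: "hnorm ?H = norm"
    by (simp add: fun_eq_iff hnorm_def norm_eq_sqrt_cinner)
  have complete: "\<exists>f\<in>UNIV. (\<lambda>n. norm (X n - f)) \<longlonglongrightarrow> 0"
    if "\<forall>e>0. \<exists>M. \<forall>m\<ge>M. \<forall>n\<ge>M. norm (X m - X n) < e" for X :: "nat \<Rightarrow> 'a"
  proof -
    have "Cauchy X" using that by (simp add: Cauchy_def dist_norm)
    then obtain f where "X \<longlonglongrightarrow> f" using Cauchy_convergent convergent_def by blast
    thus ?thesis using LIM_zero tendsto_norm_zero by blast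
  qed
  show "hilbert_carrier ?H"
    unfolding hilbert_carrier_def hilbert_space_def n inner_space.simps
    by (intro conjI ballI allI impI; (rule cinner_commute | erule conjE, erule complete |
        simp add: cinner_add_left cinner_scaleC_left cinner_self complex_nonneg_Reals_iff
          del: of_real_power))
qed simp_all

lemma bounded_clinear_scaleC: "bounded_clinear (\<lambda>x::'a::complex_hilbert. c *\<^sub>C x)"
  unfolding bounded_clinear_def
proof (intro conjI allI)
  show "bounded_linear (\<lambda>x::'a. c *\<^sub>C x)"
    by (rule bounded_linear_intro[of _ "cmod c"])
      (simp_all add: scaleC_add_right hilbert_type.N_scale scaleC_of_real[symmetric]
        scaleC_scaleC mult.commute)
  show "c *\<^sub>C d *\<^sub>C x = d *\<^sub>C c *\<^sub>C x" for d and x :: 'a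
    by (simp add: scaleC_scaleC mult.commute)
qed

lemma bounded_clinear_tendsto:
  assumes "bounded_clinear T" "(f \<longlongrightarrow> x) F"
  shows "((\<lambda>n. T (f n)) \<longlongrightarrow> T x) F"
  using assms by (simp add: bounded_clinear_def bounded_linear.tendsto)

lemmas tendsto_scaleC = bounded_clinear_tendsto[OF bounded_clinear_scaleC]

section \<open>Operators on the Hilbert tensor product\<close>

locale hilbert_tensor_product =
  fixes tens :: "'a::complex_hilbert \<Rightarrow> 'b::complex_hilbert \<Rightarrow> 'c::complex_hilbert"
  assumes hilbert_tensor: "hilbert_tensor tens"
begin

lemma tens_scale_left: "tens (c *\<^sub>C a) b = c *\<^sub>C tens a b"
  and tens_scale_right: "tens a (c *\<^sub>C b) = c *\<^sub>C tens a b"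
  and cinner_tens: "cinner (tens a b) (tens a' b') = cinner a a' * cinner b b'"
  and closure_span_tens: "closure (complex_vector.span {tens a b | a b. True}) = UNIV"
  using hilbert_tensor unfolding hilbert_tensor_def by blast+

lemma tens_minus_left: "tens (- a) b = - tens a b"
  using tens_scale_left[of "- 1" a b] by simp

lemma norm_tens: "norm (tens a b) = norm a * norm b"
  by (simp add: norm_eq_sqrt_cinner cinner_tens) (simp add: cinner_self real_sqrt_mult del: of_real_power)

text \<open>An orthonormalization of the \<open>b i\<close> turns both sums into sums of squared norms.\<close>

lemma norm_sum_tens_le:
  fixes a :: "nat \<Rightarrow> 'a"
  assumes A: "bounded_clinear A" and M: "\<And>x. norm (A x) \<le> M * norm x" "M \<ge> 0"
  shows "norm (\<Sum>i<n. tens (A (a i)) (b i)) \<le> M * norm (\<Sum>i<n. tens (a i) (b i))"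
proof -
  obtain v :: "nat \<Rightarrow> nat \<Rightarrow> complex"
    where v: "\<forall>i<n. \<forall>j<n. cinner (b i) (b j) = (\<Sum>k<n. v k i * cnj (v k j))"
    using hilbert_type.gram_factorization[of n b] by auto
  have sq: "(norm (\<Sum>i<n. tens (f i) (b i)))\<^sup>2 = (\<Sum>k<n. (norm (\<Sum>i<n. v k i *\<^sub>C f i))\<^sup>2)" for f
  proof -
    have "complex_of_real ((norm (\<Sum>i<n. tens (f i) (b i)))\<^sup>2) =
        (\<Sum>i<n. \<Sum>j<n. cinner (f i) (f j) * cinner (b i) (b j))"
      unfolding cinner_self[symmetric]
      by (simp add: hilbert_type.ip_sum_left hilbert_type.ip_sum_right cinner_tens)
        (rule sum.swap)
    also have "\<dots> = (\<Sum>i<n. \<Sum>j<n. cinner (f i) (f j) * (\<Sum>k<n. v k i * cnj (v k j)))"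
      using v by (intro sum.cong refl) simp
    also have "\<dots> = complex_of_real (\<Sum>k<n. (norm (\<Sum>i<n. v k i *\<^sub>C f i))\<^sup>2)"
      by (rule hilbert_type.gram_schur) simp
    finally show ?thesis by (simp only: of_real_eq_iff)
  qed
  \<comment> \<open>\<open>A\<close> touches only the first factor and so commutes with taking the
    coordinate \<open>k\<close>; its bound can be used in each coordinate separately.\<close>
  have "(\<Sum>i<n. v k i *\<^sub>C A (a i)) = A (\<Sum>i<n. v k i *\<^sub>C a i)" for k
    using A unfolding bounded_clinear_def
    by (simp add: linear_sum[OF bounded_linear.linear])
  hence "(norm (\<Sum>i<n. tens (A (a i)) (b i)))\<^sup>2 = (\<Sum>k<n. (norm (A (\<Sum>i<n. v k i *\<^sub>C a i)))\<^sup>2)"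
    by (simp add: sq)
  also have "\<dots> \<le> (\<Sum>k<n. (M * norm (\<Sum>i<n. v k i *\<^sub>C a i))\<^sup>2)"
    using M by (intro sum_mono power_mono) auto
  also have "\<dots> = (M * norm (\<Sum>i<n. tens (a i) (b i)))\<^sup>2"
    by (simp add: sq power_mult_distrib sum_distrib_left)
  finally show ?thesis using M(2) by (simp add: power2_le_iff_abs_le)
qed

text \<open>Linearity spreads the agreement to the span of elementary tensors, continuity to its
  closure, which is everything.\<close>

lemma bounded_clinear_eqI:
  assumes "bounded_clinear T" "bounded_clinear T'" "\<And>a b. T (tens a b) = T' (tens a b)"
  shows "T = T'"
proof -
  have lin: "linear T" "linear T'" and cont: "continuous_on UNIV T" "continuous_on UNIV T'"
    using assms(1,2) by (simp_all add: bounded_clinear_def bounded_linear.linear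
        linear_continuous_on)
  have "T x = T' x" if "x \<in> complex_vector.span {tens a b | a b. True}" for x
    using that
  proof (rule complex_vector.span_induct)
    show "complex_vector.subspace {x. T x = T' x}"
      using assms(1,2) lin
      by (auto simp: complex_vector.subspace_def bounded_clinear_def linear_0 linear_add)
  qed (use assms(3) in auto)
  moreover have "closed {x. T x = T' x}"
    using closed_Collect_eq[of T T'] cont by simp
  ultimately have "closure (complex_vector.span {tens a b | a b. True}) \<subseteq> {x. T x = T' x}"
    by (intro closure_minimal) auto
  thus ?thesis unfolding closure_span_tens by auto
qed

text \<open>Resolves the definite description: uniqueness holds by totality, so exhibiting one
  suitable operator computes \<open>op_tensor\<close>.\<close>

lemma op_tensor_eqI:
  assumes "bounded_clinear T" "\<And>a b. T (tens a b) = tens (A a) (B b)"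
  shows "op_tensor tens A B = T"
  unfolding op_tensor_def
proof (rule the_equality)
  show "bounded_clinear T \<and> (\<forall>a b. T (tens a b) = tens (A a) (B b))"
    using assms by blast
  show "T' = T" if "bounded_clinear T' \<and> (\<forall>a b. T' (tens a b) = tens (A a) (B b))" for T'
    by (rule bounded_clinear_eqI) (use that assms in auto)
qed

text \<open>Makes the product kernel again a scalar multiple of the identity.\<close>

lemma op_tensor_scaleC:
  "op_tensor tens (\<lambda>a. c *\<^sub>C a) (\<lambda>b. d *\<^sub>C b) = (\<lambda>x. (c * d) *\<^sub>C x)"
  by (rule op_tensor_eqI)
    (simp_all add: bounded_clinear_scaleC tens_scale_left tens_scale_right scaleC_scaleC)

section \<open>Construction of \<open>A \<otimes> I\<close>\<close>

lemma span_tens_sum_list: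
  assumes "x \<in> complex_vector.span {tens a b | a b. True}"
  obtains ps where "x = (\<Sum>(a, b)\<leftarrow>ps. tens a b)"
proof -
  have "\<exists>ps. x = (\<Sum>(a, b)\<leftarrow>ps. tens a b)"
    using assms
  proof (induction rule: complex_vector.span_induct_alt)
    case base
    show ?case by (rule exI[of _ "[]"]) simp
  next
    case (step c x y)
    then obtain a b ps where "x = tens a b" "y = (\<Sum>(a, b)\<leftarrow>ps. tens a b)"
      by auto
    thus ?case
      by (intro exI[of _ "(c *\<^sub>C a, b) # ps"]) (simp add: tens_scale_left)
  qed
  thus ?thesis using that by blast
qed

text \<open>\<open>A \<otimes> I\<close> is the closure of its graph on finite sums of elementary tensors.\<close>

lemma op_tensor_id_exists:
  assumes A: "bounded_clinear A"
  shows "\<exists>T. bounded_clinear T \<and> (\<forall>a b. T (tens a b) = tens (A a) b)"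
proof -
  obtain M where M: "M \<ge> 0" "\<And>x. norm (A x) \<le> M * norm x"
    using A bounded_linear.nonneg_bounded unfolding bounded_clinear_def
    by (metis mult.commute)
  have linA: "A (c *\<^sub>C x) = c *\<^sub>C A x" "A (- x) = - A x" for c x
    using A by (simp_all add: bounded_clinear_def linear_neg bounded_linear.linear)
  define t where "t ps = (\<Sum>(a, b)\<leftarrow>ps. tens a b)" for ps
  define s where "s ps = (\<Sum>(a, b)\<leftarrow>ps. tens (A a) b)" for ps
  define sc where "sc c ps = map (\<lambda>(a, b). (c *\<^sub>C a, b)) ps" for c and ps :: "('a \<times> 'b) list"
  have t_simps: "t (ps @ qs) = t ps + t qs" "t (sc c ps) = c *\<^sub>C t ps" for ps qs c
    unfolding t_def sc_def
    by simp (induction ps, auto simp: scaleC_add_right tens_scale_left)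
  have s_simps: "s (ps @ qs) = s ps + s qs" "s (sc c ps) = c *\<^sub>C s ps" for ps qs c
    unfolding s_def sc_def
    by simp (induction ps, auto simp: scaleC_add_right tens_scale_left linA)
  have bound: "norm (s ps) \<le> M * norm (t ps)" for ps
    using norm_sum_tens_le[OF A M(2,1), of "\<lambda>i. fst (ps ! i)" "\<lambda>i. snd (ps ! i)" "length ps"]
    by (simp add: s_def t_def sum_list_sum_nth atLeast0LessThan case_prod_beta)
  \<comment> \<open>A relation, because many lists represent the same tensor. Linearity of
    \<open>R\<close> together with \<open>bound\<close> makes it single valued, which settles
    well-definedness and the extension to the closure at once.\<close>
  define R where "R x y \<longleftrightarrow> (\<exists>p. (\<lambda>n::nat. t (p n)) \<longlonglongrightarrow> x \<and> (\<lambda>n. s (p n)) \<longlonglongrightarrow> y)" for x y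
  have R_add: "R (x + x') (y + y')" if R: "R x y" "R x' y'" for x y x' y'
  proof -
    obtain p q where "(\<lambda>n. t (p n)) \<longlonglongrightarrow> x" "(\<lambda>n. s (p n)) \<longlonglongrightarrow> y"
      "(\<lambda>n. t (q n)) \<longlonglongrightarrow> x'" "(\<lambda>n. s (q n)) \<longlonglongrightarrow> y'"
      using R unfolding R_def by blast
    thus ?thesis
      unfolding R_def by (intro exI[of _ "\<lambda>n. p n @ q n"]) (simp add: t_simps s_simps tendsto_add)
  qed
  have R_scale: "R (c *\<^sub>C x) (c *\<^sub>C y)" if R: "R x y" for c x y
  proof -
    obtain p where "(\<lambda>n. t (p n)) \<longlonglongrightarrow> x" "(\<lambda>n. s (p n)) \<longlonglongrightarrow> y"
      using R unfolding R_def by blast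
    thus ?thesis
      unfolding R_def by (intro exI[of _ "\<lambda>n. sc c (p n)"]) (simp add: t_simps s_simps tendsto_scaleC)
  qed
  have R_bound: "norm y \<le> norm x * M" if R: "R x y" for x y
  proof -
    obtain p where p: "(\<lambda>n. t (p n)) \<longlonglongrightarrow> x" "(\<lambda>n. s (p n)) \<longlonglongrightarrow> y"
      using R unfolding R_def by blast
    have "(\<lambda>n. norm (s (p n))) \<longlonglongrightarrow> norm y"
      using p by (intro tendsto_intros)
    moreover have "(\<lambda>n. norm (t (p n)) * M) \<longlonglongrightarrow> norm x * M"
      using p by (intro tendsto_intros)
    ultimately show ?thesis
      by (rule LIMSEQ_le) (use bound in \<open>auto simp: mult.commute\<close>)
  qed
  have R_diff: "R (x - x') (y - y')" if "R x y" "R x' y'" for x x' y y'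
    using R_add[OF that(1) R_scale[OF that(2), of "-1"]] by simp
  have unique: "y = y'" if "R x y" "R x y'" for x y y'
    using R_bound[OF R_diff[OF that]] by simp
  have "\<exists>y. R x y" for x
  proof -
    have "x \<in> closure (complex_vector.span {tens a b | a b. True})"
      using closure_span_tens by simp
    then obtain X where X: "\<And>n. X n \<in> complex_vector.span {tens a b | a b. True}" "X \<longlonglongrightarrow> x"
      unfolding closure_sequential by blast
    have "\<forall>n. \<exists>ps. X n = t ps"
      using span_tens_sum_list[OF X(1)] unfolding t_def by metis
    then obtain p where p: "\<And>n. X n = t (p n)" by metis
    have diff: "norm (s (p m) - s (p n)) \<le> M * norm (X m - X n)" for m n
      using bound[of "p m @ sc (-1) (p n)"] by (simp add: t_simps s_simps p)
    have "Cauchy (\<lambda>n. s (p n))"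
    proof (rule metric_CauchyI)
      fix e :: real assume "e > 0"
      \<comment> \<open>\<open>M + 1\<close> keeps the divisor positive when
        \<open>M = 0\<close>.\<close>
      hence "e / (M + 1) > 0" using M by simp
      then obtain k where k: "\<And>m n. m \<ge> k \<Longrightarrow> n \<ge> k \<Longrightarrow> norm (X m - X n) < e / (M + 1)"
        using LIMSEQ_imp_Cauchy[OF X(2)] unfolding Cauchy_def dist_norm by blast
      have "norm (s (p m) - s (p n)) < e" if "m \<ge> k" "n \<ge> k" for m n
      proof -
        have "norm (s (p m) - s (p n)) \<le> (M + 1) * norm (X m - X n)"
          using diff[of m n] by (simp add: algebra_simps) (smt (verit) norm_ge_zero)
        also have "\<dots> < e"
          using k[OF that] M by (simp add: pos_less_divide_eq mult.commute)
        finally show ?thesis .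
      qed
      thus "\<exists>k. \<forall>m\<ge>k. \<forall>n\<ge>k. dist (s (p m)) (s (p n)) < e"
        by (auto simp: dist_norm)
    qed
    then obtain y where "(\<lambda>n. s (p n)) \<longlonglongrightarrow> y"
      using Cauchy_convergent convergent_def by blast
    thus ?thesis using X(2) unfolding R_def p by blast
  qed
  then obtain T where T: "\<And>x. R x (T x)" by metis
  have eq: "T x = y" if "R x y" for x y
    using unique[OF T that] .
  have T_scale: "T (c *\<^sub>C x) = c *\<^sub>C T x" for c x
    by (rule eq[OF R_scale[OF T]])
  have "bounded_linear T"
  proof (rule bounded_linear_intro[of _ M])
    show "T (x + y) = T x + T y" for x y by (rule eq[OF R_add[OF T T]])
    show "T (r *\<^sub>R x) = r *\<^sub>R T x" for r x
      using T_scale[of "complex_of_real r" x] by (simp add: scaleC_of_real)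
    show "norm (T x) \<le> norm x * M" for x by (rule R_bound[OF T])
  qed
  moreover have "T (tens a b) = tens (A a) b" for a b
    by (rule eq, unfold R_def, rule exI[of _ "\<lambda>_. [(a, b)]"]) (simp add: t_def s_def)
  ultimately show ?thesis
    using T_scale unfolding bounded_clinear_def by blast
qed

lemma op_tensor_id:
  assumes "bounded_clinear A"
  shows "op_tensor tens A id (tens a b) = tens (A a) b"
proof -
  obtain T where "bounded_clinear T" "\<And>a b. T (tens a b) = tens (A a) b"
    using op_tensor_id_exists[OF assms] by blast
  thus ?thesis using op_tensor_eqI[of T A id] by simp
qed

end

section \<open>Reproducing kernels that are multiples of the identity\<close>

locale rkhs_times_id = hilbert_carrier H
  for k :: "'l \<Rightarrow> 'l \<Rightarrow> complex" and H :: "('l \<Rightarrow> 'e::complex_hilbert) inner_space" +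
  assumes rkhs: "rkhs (times_id k) H"
begin

abbreviation ker :: "'l \<Rightarrow> 'e \<Rightarrow> 'l \<Rightarrow> 'e" where
  "ker y \<eta> \<equiv> (\<lambda>x. k x y *\<^sub>C \<eta>)"

abbreviation ker_span :: "('l \<Rightarrow> 'e) set" where
  "ker_span \<equiv> complex_vector.span {ker y \<eta> | y \<eta>. True}"

lemma dense_ker_span: "dense_in ker_span H"
  and reproducing: "f \<in> S \<Longrightarrow> ip f (ker y \<eta>) = cinner (f y) \<eta>"
  using rkhs by (simp_all add: rkhs_def times_id_def)

lemma ker_span_mem: "f \<in> ker_span \<Longrightarrow> f \<in> S"
  using dense_ker_span by (auto simp: dense_in_def)

lemma ker_mem [simp]: "ker y \<eta> \<in> S"
  by (rule ker_span_mem, rule complex_vector.span_base) blast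

lemma ip_ker: "ip (ker y \<eta>) (ker z \<zeta>) = k z y * cinner \<eta> \<zeta>"
  by (simp add: reproducing hilbert_type.ip_scale_left)

lemma N_ker: "complex_of_real ((N (ker y \<eta>))\<^sup>2) = k y y * complex_of_real ((norm \<eta>)\<^sup>2)"
  unfolding ip_self[OF ker_mem, symmetric] ip_ker by (simp add: cinner_self)

lemma N_ker_le: "N (ker y \<eta>) \<le> sqrt (cmod (k y y)) * norm \<eta>"
proof -
  have "(N (ker y \<eta>))\<^sup>2 = cmod (k y y) * (norm \<eta>)\<^sup>2"
    using arg_cong[OF N_ker[of y \<eta>], of cmod] by (simp add: norm_mult norm_power del: of_real_power)
  also have "\<dots> = (sqrt (cmod (k y y)) * norm \<eta>)\<^sup>2"
    by (simp add: power_mult_distrib)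
  finally show ?thesis by (simp add: power2_eq_iff_nonneg)
qed

text \<open>Cauchy-Schwarz for the reproducing property at \<eta> = \<open>f y\<close>. It makes
  norm convergence imply pointwise convergence.\<close>

lemma norm_eval_le:
  assumes f: "f \<in> S"
  shows "norm (f y) \<le> sqrt (cmod (k y y)) * N f"
proof (cases "f y = 0")
  case False
  have "(norm (f y))\<^sup>2 = cmod (ip f (ker y (f y)))"
    unfolding reproducing[OF f] cinner_self by (simp add: norm_power)
  also have "\<dots> \<le> N f * N (ker y (f y))"
    by (rule cauchy_schwarz) (use f in simp_all)
  also have "\<dots> \<le> N f * (sqrt (cmod (k y y)) * norm (f y))"
    using f by (intro mult_left_mono N_ker_le) simp_all
  finally show ?thesis
    using False by (simp add: power2_eq_square mult_ac)
qed (use f in simp)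

lemma tendsto_eval:
  assumes "\<And>n. X n \<in> S" "f \<in> S" "(\<lambda>n. N (X n - f)) \<longlonglongrightarrow> 0"
  shows "(\<lambda>n. X n y) \<longlonglongrightarrow> f y"
proof -
  have "(\<lambda>n. X n y - f y) \<longlonglongrightarrow> 0"
  proof (rule Lim_null_comparison)
    show "\<forall>\<^sub>F n in sequentially. norm (X n y - f y) \<le> sqrt (cmod (k y y)) * N (X n - f)"
      using norm_eval_le[of "X _ - f" y] assms by (intro always_eventually) simp
    show "(\<lambda>n. sqrt (cmod (k y y)) * N (X n - f)) \<longlonglongrightarrow> 0"
      using tendsto_mult_left[OF assms(3), of "sqrt (cmod (k y y))"] by simp
  qed
  thus ?thesis by (simp add: LIM_zero_iff)
qed

text \<open>A kernel function at \<open>y\<close> has squared norm proportional to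
  \<open>k y y\<close>; if that vanished, the function would be zero, also at
  \<open>x\<close>.\<close>

lemma diagonal_nonzero:
  assumes "(\<eta>::'e) \<noteq> 0" "k x y \<noteq> 0"
  shows "k y y \<noteq> 0"
proof
  assume "k y y = 0"
  hence "N (ker y \<eta>) = 0"
    using N_ker[of y \<eta>] by simp
  hence "ker y \<eta> = 0"
    using N_eq_0[OF ker_mem] by blast
  hence "ker y \<eta> x = 0"
    by (rule fun_cong[THEN trans]) (rule zero_fun_apply)
  hence "norm (k x y *\<^sub>C \<eta>) = 0" by simp
  thus False
    using assms by (simp only: hilbert_type.N_scale[OF UNIV_I]) simp
qed

section \<open>Boundedness of multiplication operators\<close>

lemma multipliers_mem: "\<psi> \<in> multipliers H \<Longrightarrow> f \<in> S \<Longrightarrow> mult_op \<psi> f \<in> S"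
  and multipliers_bounded: "\<psi> \<in> multipliers H \<Longrightarrow> bounded_clinear (\<psi> x)"
  by (auto simp: multipliers_def)

lemma mult_op_linear:
  assumes "\<psi> \<in> multipliers H"
  shows "mult_op \<psi> (f + g) = mult_op \<psi> f + mult_op \<psi> g"
    and "mult_op \<psi> (c *\<^sub>C f) = c *\<^sub>C mult_op \<psi> f"
    and "mult_op \<psi> 0 = 0"
  using multipliers_bounded[OF assms]
  by (auto simp: mult_op_def fun_eq_iff scaleC_fun_def plus_fun_apply zero_fun_apply bounded_clinear_def
      bounded_linear.linear linear_add linear_0)

text \<open>Norm convergence of \<open>X n\<close> gives pointwise convergence of the images, that
  is, convergence against kernel functions. A norm bound survives such a weak limit.\<close>

lemma mult_op_lower_semicontinuous:
  assumes \<psi>: "\<psi> \<in> multipliers H"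
    and X: "\<And>n. X n \<in> S" "f \<in> S" "(\<lambda>n. N (X n - f)) \<longlonglongrightarrow> 0"
    and b: "\<And>n. N (mult_op \<psi> (X n)) \<le> b"
  shows "N (mult_op \<psi> f) \<le> b"
proof -
  note mem = multipliers_mem[OF \<psi>]
  have "G \<in> S \<and> (\<lambda>n. ip (mult_op \<psi> (X n)) G) \<longlonglongrightarrow> ip (mult_op \<psi> f) G"
    if "G \<in> ker_span" for G
    using that
  proof (induction rule: complex_vector.span_induct_alt)
    case base
    show ?case by (simp only: ip_zero_right zero_mem mem X tendsto_const)
  next
    case (step c g G)
    then obtain y \<eta> where g: "g = ker y \<eta>" by auto
    have gS: "g \<in> S" unfolding g by simp
    have G: "G \<in> S" and IH: "(\<lambda>n. ip (mult_op \<psi> (X n)) G) \<longlonglongrightarrow> ip (mult_op \<psi> f) G"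
      using step.IH by simp_all
    have "(\<lambda>n. \<psi> y (X n y)) \<longlonglongrightarrow> \<psi> y (f y)"
      by (rule bounded_clinear_tendsto[OF multipliers_bounded[OF \<psi>] tendsto_eval[OF X]])
    hence "(\<lambda>n. norm (\<psi> y (X n y) - \<psi> y (f y))) \<longlonglongrightarrow> 0"
      by (intro tendsto_norm_zero LIM_zero)
    hence "(\<lambda>n. cinner (\<psi> y (X n y)) \<eta>) \<longlonglongrightarrow> cinner (\<psi> y (f y)) \<eta>"
      by (intro hilbert_type.tendsto_ip_left) simp_all
    hence "(\<lambda>n. ip (mult_op \<psi> (X n)) g) \<longlonglongrightarrow> ip (mult_op \<psi> f) g"
      using X mem unfolding g by (simp add: reproducing mult_op_def)
    hence "(\<lambda>n. cnj c * ip (mult_op \<psi> (X n)) g + ip (mult_op \<psi> (X n)) G) \<longlonglongrightarrow>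
        cnj c * ip (mult_op \<psi> f) g + ip (mult_op \<psi> f) G"
      by (intro tendsto_intros IH)
    thus ?case
      using X mem G gS by (simp add: ip_add_right ip_scale_right)
  qed
  note weak = conjunct2[OF this]
  have bound: "cmod (ip (mult_op \<psi> f) G) \<le> b * N G" if G: "G \<in> ker_span" for G
  proof (rule LIMSEQ_le_const2[OF tendsto_norm[OF weak[OF G]]])
    have "cmod (ip (mult_op \<psi> (X n)) G) \<le> b * N G" for n
      using cauchy_schwarz[OF mem[OF X(1)[of n]] ker_span_mem[OF G]] b[of n]
        N_nonneg[OF ker_span_mem[OF G]]
      by (meson mult_right_mono order_trans)
    thus "\<exists>M. \<forall>n\<ge>M. cmod (ip (mult_op \<psi> (X n)) G) \<le> b * N G" by blast
  qed
  have Mf: "mult_op \<psi> f \<in> S" using mem X by simp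
  obtain G where G: "\<And>n. G n \<in> ker_span" "\<And>n. G n \<in> S"
      "(\<lambda>n. N (G n - mult_op \<psi> f)) \<longlonglongrightarrow> 0"
    using dense_in_sequence[OF dense_ker_span Mf] by blast
  \<comment> \<open>By density the bound for \<open>G\<close> in the kernel span passes to
    \<open>G = mult_op \<psi> f\<close>; dividing by the norm then gives the claim.\<close>
  have "cmod (ip (mult_op \<psi> f) (mult_op \<psi> f)) \<le> b * N (mult_op \<psi> f)"
  proof (rule LIMSEQ_le)
    show "(\<lambda>n. cmod (ip (mult_op \<psi> f) (G n))) \<longlonglongrightarrow> cmod (ip (mult_op \<psi> f) (mult_op \<psi> f))"
      by (intro tendsto_norm tendsto_ip_right G Mf)
    show "(\<lambda>n. b * N (G n)) \<longlonglongrightarrow> b * N (mult_op \<psi> f)"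
      by (intro tendsto_intros tendsto_N G Mf)
  qed (use bound G in blast)
  hence "N (mult_op \<psi> f) * N (mult_op \<psi> f) \<le> b * N (mult_op \<psi> f)"
    unfolding ip_self[OF Mf] by (simp add: norm_power power2_eq_square norm_mult)
  moreover have "0 \<le> b"
    using b[of 0] N_nonneg[OF mem[OF X(1)]] by (rule order_trans[rotated])
  ultimately show ?thesis
    using N_nonneg[OF Mf] by (cases "N (mult_op \<psi> f) = 0") auto
qed

text \<open>One step of a Baire argument: a point \<open>x + g\<close> near \<open>x\<close> has a
  large image, and by lower semicontinuity so has a whole ball around it.\<close>

lemma mult_op_large_ball:
  assumes \<psi>: "\<psi> \<in> multipliers H"
    and unbounded: "\<And>B. \<exists>f\<in>S. N (mult_op \<psi> f) > B * N f"
    and x: "x \<in> S" and r: "r > 0"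
  obtains x' r' where "x' \<in> S" "r' > 0" "r' \<le> r / 2" "N (x' - x) \<le> r / 2"
    "\<And>z. z \<in> S \<Longrightarrow> N (z - x') \<le> r' \<Longrightarrow> N (mult_op \<psi> z) > b"
proof -
  note mem = multipliers_mem[OF \<psi>] and lin = mult_op_linear[OF \<psi>]
  \<comment> \<open>The factor is chosen so that \<open>f\<close>, rescaled to norm
    \<open>r / 2\<close>, has an image of norm above
    \<open>\<bar>b\<bar> + N (mult_op \<psi> x)\<close>; the triangle inequality then leaves more
    than \<open>b\<close> at \<open>x + g\<close>.\<close>
  obtain f where f: "f \<in> S"
      "N (mult_op \<psi> f) > 2 * (\<bar>b\<bar> + N (mult_op \<psi> x)) / r * N f"
    using unbounded by blast
  have "N f \<noteq> 0"
    using f lin by (auto simp: N_eq_0)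
  hence Nf: "N f > 0" using N_nonneg[OF f(1)] by simp
  define g where "g = complex_of_real (r / (2 * N f)) *\<^sub>C f"
  have g: "g \<in> S" "N g = r / 2"
    using f Nf r by (simp_all add: g_def N_scale norm_divide norm_mult)
  have "N (mult_op \<psi> g) = r / (2 * N f) * N (mult_op \<psi> f)"
    unfolding g_def lin N_scale[OF mem[OF f(1)]] using Nf r by (simp add: norm_divide norm_mult)
  also have "\<dots> > r / (2 * N f) * (2 * (\<bar>b\<bar> + N (mult_op \<psi> x)) / r * N f)"
    using f(2) Nf r by (intro mult_strict_left_mono) simp_all
  also have "r / (2 * N f) * (2 * (\<bar>b\<bar> + N (mult_op \<psi> x)) / r * N f) = \<bar>b\<bar> + N (mult_op \<psi> x)"
    using Nf r by simp
  finally have "N (mult_op \<psi> g) > \<bar>b\<bar> + N (mult_op \<psi> x)" .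
  moreover have "N (mult_op \<psi> g) \<le> N (mult_op \<psi> (x + g)) + N (mult_op \<psi> x)"
    using N_triangle[of "mult_op \<psi> (x + g)" "- 1 *\<^sub>C mult_op \<psi> x"]
      N_scale[of "mult_op \<psi> x" "- 1"] mem x g(1)
    by (simp add: lin)
  ultimately have large: "N (mult_op \<psi> (x + g)) > b" by linarith
  \<comment> \<open>Otherwise points with image of norm at most \<open>b\<close> would converge to
    \<open>x + g\<close>, and the bound would pass to the limit.\<close>
  have "\<exists>r'>0. r' \<le> r / 2 \<and> (\<forall>z\<in>S. N (z - (x + g)) \<le> r' \<longrightarrow> N (mult_op \<psi> z) > b)"
  proof (rule ccontr)
    assume contr: "\<not> ?thesis"
    have "\<exists>z\<in>S. N (z - (x + g)) \<le> min (r / 2) (inverse (real (Suc n))) \<and> N (mult_op \<psi> z) \<le> b"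
      for n
    proof -
      define e where "e = min (r / 2) (inverse (real (Suc n)))"
      have "e > 0" "e \<le> r / 2" using r by (simp_all add: e_def)
      with contr have "\<not> (\<forall>z\<in>S. N (z - (x + g)) \<le> e \<longrightarrow> N (mult_op \<psi> z) > b)"
        by blast
      thus ?thesis unfolding e_def[symmetric] by (meson not_less)
    qed
    then obtain Z where Z: "\<And>n. Z n \<in> S"
        "\<And>n. N (Z n - (x + g)) \<le> min (r / 2) (inverse (real (Suc n)))"
        "\<And>n. N (mult_op \<psi> (Z n)) \<le> b"
      by metis
    have lim: "(\<lambda>n. N (Z n - (x + g))) \<longlonglongrightarrow> 0"
      by (rule tendsto_sandwich[OF _ _ tendsto_const LIMSEQ_inverse_real_of_nat])
        (use Z x g in auto)
    have "N (mult_op \<psi> (x + g)) \<le> b"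
      by (rule mult_op_lower_semicontinuous[OF \<psi> Z(1) _ lim Z(3)]) (use x g in simp)
    thus False using large by simp
  qed
  then obtain r' where "r' > 0" "r' \<le> r / 2"
      "\<And>z. z \<in> S \<Longrightarrow> N (z - (x + g)) \<le> r' \<Longrightarrow> N (mult_op \<psi> z) > b"
    by blast
  thus ?thesis using that[of "x + g" r'] x g by simp
qed

text \<open>Nested balls on which the operator exceeds every \<open>n\<close> shrink to a point.\<close>

lemma mult_op_bounded:
  assumes \<psi>: "\<psi> \<in> multipliers H"
  shows "\<exists>B. \<forall>f\<in>S. N (mult_op \<psi> f) \<le> B * N f"
proof (rule ccontr)
  assume "\<not> ?thesis"
  hence unbounded: "\<And>B. \<exists>f\<in>S. N (mult_op \<psi> f) > B * N f"
    by (auto simp: not_le)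
  have "\<exists>p :: nat \<Rightarrow> ('l \<Rightarrow> 'e) \<times> real. \<forall>n. (fst (p n) \<in> S \<and> snd (p n) > 0) \<and>
      (snd (p (Suc n)) \<le> snd (p n) / 2 \<and> N (fst (p (Suc n)) - fst (p n)) \<le> snd (p n) / 2 \<and>
       (\<forall>z\<in>S. N (z - fst (p (Suc n))) \<le> snd (p (Suc n)) \<longrightarrow> N (mult_op \<psi> z) > real n))"
  proof (rule dependent_nat_choice)
    show "\<exists>p :: ('l \<Rightarrow> 'e) \<times> real. fst p \<in> S \<and> snd p > 0"
      by (rule exI[of _ "(0, 1)"]) simp
    fix p :: "('l \<Rightarrow> 'e) \<times> real" and n :: nat
    assume p: "fst p \<in> S \<and> snd p > 0"
    show "\<exists>q. (fst q \<in> S \<and> snd q > 0) \<and> snd q \<le> snd p / 2 \<and> N (fst q - fst p) \<le> snd p / 2 \<and>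
        (\<forall>z\<in>S. N (z - fst q) \<le> snd q \<longrightarrow> N (mult_op \<psi> z) > real n)"
      using mult_op_large_ball[OF \<psi> unbounded conjunct1[OF p] conjunct2[OF p], of "real n"]
      by (metis fst_conv snd_conv)
  qed
  then obtain p :: "nat \<Rightarrow> ('l \<Rightarrow> 'e) \<times> real" where p:
      "\<And>n. fst (p n) \<in> S" "\<And>n. snd (p n) > 0" "\<And>n. snd (p (Suc n)) \<le> snd (p n) / 2"
      "\<And>n. N (fst (p (Suc n)) - fst (p n)) \<le> snd (p n) / 2"
      "\<And>n z. z \<in> S \<Longrightarrow> N (z - fst (p (Suc n))) \<le> snd (p (Suc n)) \<Longrightarrow>
        N (mult_op \<psi> z) > real n"
    by blast
  define X r where "X n = fst (p n)" and "r n = snd (p n)" for n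
  note p = p[folded X_def r_def]
  \<comment> \<open>A centre moves by at most \<open>r m / 2\<close>, and since the radius at least
    halves this is at most \<open>r m - r (Suc m)\<close>; the bounds telescope. They put the limit
    of the centres into every ball.\<close>
  have nested: "N (X m - X n) \<le> r n - r m" if "n \<le> m" for m n
    using that
  proof (induction rule: dec_induct)
    case base
    show ?case unfolding diff_self N_zero by simp
  next
    case (step m)
    thus ?case
      using N_triangle_diff[of "X (Suc m)" "X m" "X n"] p(1,3,4)[of m] p(1)[of "Suc m"] p(1)[of n]
      by linarith
  qed
  have geometric: "r n \<le> r 0 * (1 / 2) ^ n" for n
  proof (induction n)
    case (Suc n)
    thus ?case using p(3)[of n] by simp
  qed simp
  have lim: "(\<lambda>n. r 0 * (1 / 2) ^ n) \<longlonglongrightarrow> 0"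
    by (intro tendsto_mult_right_zero LIMSEQ_realpow_zero) simp_all
  have r0: "r \<longlonglongrightarrow> 0"
    by (rule tendsto_sandwich[OF _ _ tendsto_const lim])
      (simp_all add: geometric less_imp_le[OF p(2)])
  have "\<exists>M. \<forall>m\<ge>M. \<forall>n\<ge>M. N (X m - X n) < e" if "e > 0" for e
  proof -
    obtain M where M: "r M < e / 2"
      using order_tendstoD(2)[OF r0, of "e / 2"] \<open>e > 0\<close> by (auto simp: eventually_sequentially)
    have "N (X m - X n) < e" if "m \<ge> M" "n \<ge> M" for m n
      using N_triangle_diff[OF p(1) p(1) p(1), of m n M] nested[OF that(1)] nested[OF that(2)]
        N_minus_commute[OF p(1) p(1), of M n] p(2)[of m] p(2)[of n] M
      by linarith
    thus ?thesis by blast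
  qed
  then obtain z where z: "z \<in> S" "(\<lambda>n. N (X n - z)) \<longlonglongrightarrow> 0"
    using complete[of X] p(1) by blast
  have "N (z - X n) \<le> r n" for n
  proof (rule LIMSEQ_le_const2)
    have "(\<lambda>m. N ((X m - X n) - (z - X n))) \<longlonglongrightarrow> 0"
      using z by simp
    thus "(\<lambda>m. N (X m - X n)) \<longlonglongrightarrow> N (z - X n)"
      by (rule tendsto_N[rotated 2]) (use p(1) z in simp_all)
    show "\<exists>M. \<forall>m\<ge>M. N (X m - X n) \<le> r n"
      using nested p(2) by (intro exI[of _ n]) (smt (verit))
  qed
  hence "N (mult_op \<psi> z) > real n" for n
    using p(5)[OF z(1)] by blast
  thus False
    using reals_Archimedean2[of "N (mult_op \<psi> z)"] less_asym by blast
qed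

text \<open>The supremum in \<open>op_norm\<close> is an upper bound because
  \<open>mult_op_bounded\<close> bounds the set; the rest is rescaling \<open>f\<close> to norm
  1.\<close>

lemma mult_op_le_op_norm:
  assumes \<psi>: "\<psi> \<in> multipliers H" and f: "f \<in> S"
  shows "N (mult_op \<psi> f) \<le> op_norm H (mult_op \<psi>) * N f"
proof (cases "f = 0")
  case True
  thus ?thesis by (simp add: mult_op_linear[OF \<psi>])
next
  case False
  hence Nf: "N f > 0" using f N_nonneg[OF f] N_eq_0[OF f] by linarith
  obtain B where B: "\<And>f. f \<in> S \<Longrightarrow> N (mult_op \<psi> f) \<le> B * N f"
    using mult_op_bounded[OF \<psi>] by blast
  have "N (mult_op \<psi> g) \<le> \<bar>B\<bar>" if "g \<in> S" "N g \<le> 1" for g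
  proof -
    have "B * N g \<le> \<bar>B\<bar> * 1"
      using that by (intro mult_mono) simp_all
    thus ?thesis using B[OF that(1)] by simp
  qed
  hence bdd: "bdd_above {N (mult_op \<psi> f) | f. f \<in> S \<and> N f \<le> 1}"
    by (intro bdd_aboveI) auto
  define c where "c = complex_of_real (1 / N f)"
  have "N (mult_op \<psi> (c *\<^sub>C f)) \<le> op_norm H (mult_op \<psi>)"
    unfolding op_norm_def
    using f Nf by (intro cSup_upper[OF _ bdd]) (auto simp: c_def N_scale norm_divide)
  thus ?thesis
    using Nf unfolding mult_op_linear[OF \<psi>] N_scale[OF multipliers_mem[OF \<psi> f]]
    by (simp add: c_def norm_divide divide_simps)
qed

end

lemma (in hilbert_carrier) op_norm_isometry_le:
  assumes "isometry_on H T"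
  shows "op_norm H T \<le> 1"
  unfolding op_norm_def
proof (rule cSup_least)
  have "N (T 0) \<in> {N (T f) | f. f \<in> S \<and> N f \<le> 1}"
    using zero_mem N_zero by fastforce
  thus "{N (T f) | f. f \<in> S \<and> N f \<le> 1} \<noteq> {}" by blast
qed (use assms in \<open>auto simp: isometry_on_def\<close>)

section \<open>Scalar functions times a fixed vector\<close>

locale scalar_vector_rkhs =
  sc: rkhs_times_id k H + vec: rkhs_times_id k HE
  for k :: "'l \<Rightarrow> 'l \<Rightarrow> complex"
    and H :: "('l \<Rightarrow> complex) inner_space"
    and HE :: "('l \<Rightarrow> 'e::complex_hilbert) inner_space"
begin

text \<open>The elementary tensor f \<otimes> a, when the space of the kernel k I is viewed as the
  tensor product of the scalar space with the value space.\<close>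

abbreviation vmul :: "('l \<Rightarrow> complex) \<Rightarrow> 'e \<Rightarrow> 'l \<Rightarrow> 'e" where
  "vmul f a \<equiv> (\<lambda>x. f x *\<^sub>C a)"

lemma vmul_linear:
  "vmul (f + g) a = vmul f a + vmul g a" "vmul (f - g) a = vmul f a - vmul g a"
  "vmul (c *\<^sub>C f) a = c *\<^sub>C vmul f a" "vmul 0 a = 0"
  by (simp_all add: fun_eq_iff plus_fun_apply zero_fun_apply scaleC_fun_def scaleC_complex_def
      scaleC_add_left scaleC_scaleC complex_vector.scale_left_diff_distrib)

text \<open>The induction runs over \<open>f\<close> in the second argument only, where the
  reproducing property evaluates \<open>g\<close>. Membership of \<open>vmul g a\<close> is a
  premise because it is obtained for general \<open>g\<close> only afterwards, by
  completion.\<close>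

lemma vmul_ker_span:
  assumes "f \<in> sc.ker_span"
  shows "f \<in> sc.S \<and> vmul f a \<in> vec.S \<and>
    (\<forall>g\<in>sc.S. vmul g a \<in> vec.S \<longrightarrow> vec.ip (vmul g a) (vmul f a) = sc.ip g f * cinner a a)"
  using assms
proof (induction rule: complex_vector.span_induct_alt)
  case base
  show ?case by (simp add: vmul_linear)
next
  case (step c f' f)
  then obtain y d where f': "f' = sc.ker y d" by auto
  have eq: "vmul f' a = vec.ker y (d *\<^sub>C a)"
    by (simp add: f' fun_eq_iff scaleC_complex_def scaleC_scaleC)
  have mem: "f' \<in> sc.S" "vmul f' a \<in> vec.S"
    unfolding eq by (simp only: f' sc.ker_mem) (rule vec.ker_mem)
  have "vec.ip (vmul g a) (vmul f' a) = sc.ip g f' * cinner a a" if "g \<in> sc.S" "vmul g a \<in> vec.S" for g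
    unfolding eq vec.reproducing[OF that(2)] unfolding f' sc.reproducing[OF that(1)]
    by (simp add: hilbert_type.ip_scale_left hilbert_type.ip_scale_right cinner_complex_def)
  thus ?case
    using step.IH mem
    by (simp add: vmul_linear vec.ip_add_right sc.ip_add_right vec.ip_scale_right sc.ip_scale_right
        distrib_right mult.assoc)
qed

text \<open>On the kernel span \<open>vmul\<close> scales norms by \<open>norm a\<close>, so it
  carries a Cauchy sequence for \<open>f\<close> to a Cauchy sequence; continuity of evaluations
  identifies the limit as \<open>vmul f a\<close>.\<close>

lemma vmul_mem_norm:
  assumes f: "f \<in> sc.S"
  shows "vmul f a \<in> vec.S" "vec.N (vmul f a) = sc.N f * norm a"
proof -
  have span: "vmul g a \<in> vec.S" "vec.N (vmul g a) = sc.N g * norm a" if "g \<in> sc.ker_span" for g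
  proof -
    note * = vmul_ker_span[OF that, of a]
    show mem: "vmul g a \<in> vec.S" using * by blast
    have "vec.ip (vmul g a) (vmul g a) = sc.ip g g * cinner a a" using * by blast
    hence "(vec.N (vmul g a))\<^sup>2 = (sc.N g * norm a)\<^sup>2"
      using mem * unfolding cinner_self vec.ip_self[OF mem] sc.ip_self[OF conjunct1[OF *]]
      by (simp only: of_real_mult[symmetric] of_real_eq_iff power_mult_distrib)
    thus "vec.N (vmul g a) = sc.N g * norm a"
      using mem * by (simp add: power2_eq_iff_nonneg)
  qed
  obtain X where X: "\<And>n. X n \<in> sc.ker_span" "\<And>n. X n \<in> sc.S" "(\<lambda>n. sc.N (X n - f)) \<longlonglongrightarrow> 0"
    using sc.dense_in_sequence[OF sc.dense_ker_span f] by blast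
  have dist: "vec.N (vmul (X m) a - vmul (X n) a) = sc.N (X m - X n) * norm a" for m n
    using span(2)[OF complex_vector.span_diff[OF X(1)[of m] X(1)[of n]]] unfolding vmul_linear .
  have "\<exists>M. \<forall>m\<ge>M. \<forall>n\<ge>M. vec.N (vmul (X m) a - vmul (X n) a) < e" if "e > 0" for e
  proof -
    \<comment> \<open>The added 1 covers \<open>a = 0\<close>.\<close>
    have "e / (norm a + 1) > 0"
      using that by (simp add: add_nonneg_pos)
    then obtain M where M: "\<And>m n. m \<ge> M \<Longrightarrow> n \<ge> M \<Longrightarrow> sc.N (X m - X n) < e / (norm a + 1)"
      using sc.limit_Cauchy[OF X(2) f X(3)] by blast
    have "sc.N (X m - X n) * norm a < e" if "m \<ge> M" "n \<ge> M" for m n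
    proof -
      have "sc.N (X m - X n) * norm a \<le> sc.N (X m - X n) * (norm a + 1)"
        using X(2) by (intro mult_left_mono) simp_all
      also have "\<dots> < e"
        using M[OF that] by (simp add: pos_less_divide_eq add_nonneg_pos)
      finally show ?thesis .
    qed
    thus ?thesis unfolding dist by blast
  qed
  then obtain h where h: "h \<in> vec.S" "(\<lambda>n. vec.N (vmul (X n) a - h)) \<longlonglongrightarrow> 0"
    using vec.complete[of "\<lambda>n. vmul (X n) a"] span(1)[OF X(1)] by blast
  have "h y = f y *\<^sub>C a" for y
  proof (rule LIMSEQ_unique)
    show "(\<lambda>n. X n y *\<^sub>C a) \<longlonglongrightarrow> h y"
      by (rule vec.tendsto_eval[OF span(1)[OF X(1)] h])
    have "(\<lambda>n. norm (X n y - f y) * norm a) \<longlonglongrightarrow> 0"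
      by (intro tendsto_mult_left_zero tendsto_norm_zero LIM_zero sc.tendsto_eval[OF X(2) f X(3)])
    hence "(\<lambda>n. norm (X n y *\<^sub>C a - f y *\<^sub>C a)) \<longlonglongrightarrow> 0"
      by (simp add: complex_vector.scale_left_diff_distrib[symmetric] hilbert_type.N_scale)
    thus "(\<lambda>n. X n y *\<^sub>C a) \<longlonglongrightarrow> f y *\<^sub>C a"
      by (rule LIM_zero_cancel[OF tendsto_norm_zero_cancel])
  qed
  hence h_eq: "h = vmul f a" by blast
  show "vmul f a \<in> vec.S" using h h_eq by simp
  have "(\<lambda>n. sc.N (X n) * norm a) \<longlonglongrightarrow> vec.N (vmul f a)"
    using vec.tendsto_N[OF span(1)[OF X(1)] h] unfolding span(2)[OF X(1)] h_eq .
  moreover have "(\<lambda>n. sc.N (X n) * norm a) \<longlonglongrightarrow> sc.N f * norm a"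
    by (intro tendsto_intros sc.tendsto_N[OF X(2) f X(3)])
  ultimately show "vec.N (vmul f a) = sc.N f * norm a"
    by (rule LIMSEQ_unique)
qed

end

section \<open>Restriction to the diagonal\<close>

text \<open>A list of triples stands for the element \<open>\<Sum> f \<otimes> g \<otimes> b\<close> of the tensor product of the two
  function spaces and \<open>'b\<close>; \<open>gram\<close> is the inner product there and \<open>diag\<close> the restriction to the
  diagonal, so that the tensor product itself need not be constructed.\<close>

locale kernel_product =
  E1: rkhs_times_id k1 H1 + k2: rkhs_times_id k2 H2 +
  P: rkhs_times_id "\<lambda>x y. k1 x y * k2 x y" H + hilbert_tensor_product tens
  for k1 k2 :: "'l \<Rightarrow> 'l \<Rightarrow> complex"
    and H1 :: "('l \<Rightarrow> 'a::complex_hilbert) inner_space"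
    and H2 :: "('l \<Rightarrow> complex) inner_space"
    and H :: "('l \<Rightarrow> 'c::complex_hilbert) inner_space"
    and tens :: "'a \<Rightarrow> 'b::complex_hilbert \<Rightarrow> 'c"
begin

type_synonym ('x, 'y, 'z) triples = "(('x \<Rightarrow> 'y) \<times> ('x \<Rightarrow> complex) \<times> 'z) list"

definition triples :: "('l, 'a, 'b) triples set" where
  "triples = {xs. set xs \<subseteq> E1.S \<times> k2.S \<times> UNIV}"

definition gram :: "('l, 'a, 'b) triples \<Rightarrow> ('l, 'a, 'b) triples \<Rightarrow> complex" where
  "gram xs ys = (\<Sum>(f, g, b)\<leftarrow>xs. \<Sum>(f', g', b')\<leftarrow>ys. E1.ip f f' * k2.ip g g' * cinner b b')"

definition diag :: "('l, 'a, 'b) triples \<Rightarrow> 'l \<Rightarrow> 'c" where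
  "diag xs = (\<Sum>(f, g, b)\<leftarrow>xs. (\<lambda>x. tens (f x) (g x *\<^sub>C b)))"

lemma triples_simps [simp]:
  "[] \<in> triples" "(f, g, b) # xs \<in> triples \<longleftrightarrow> f \<in> E1.S \<and> g \<in> k2.S \<and> xs \<in> triples"
  "xs @ ys \<in> triples \<longleftrightarrow> xs \<in> triples \<and> ys \<in> triples"
  by (auto simp: triples_def)

lemma gram_Nil [simp]: "gram [] ys = 0" "gram xs [] = 0"
  unfolding gram_def by simp (induction xs, auto)

lemma gram_Cons_left: "gram (x # xs) ys = gram [x] ys + gram xs ys"
  by (simp add: gram_def)

lemma gram_Cons_right: "gram xs (y # ys) = gram xs [y] + gram xs ys"
  unfolding gram_def by (induction xs) (auto simp: algebra_simps)

lemma gram_append: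
  "gram (xs @ ys) zs = gram xs zs + gram ys zs" "gram zs (xs @ ys) = gram zs xs + gram zs ys"
proof -
  show "gram (xs @ ys) zs = gram xs zs + gram ys zs"
    by (simp add: gram_def)
  show "gram zs (xs @ ys) = gram zs xs + gram zs ys"
    unfolding gram_def by (induction zs) (auto simp: algebra_simps)
qed

lemma gram_singleton: "gram [(f, g, b)] [(f', g', b')] = E1.ip f f' * k2.ip g g' * cinner b b'"
  by (simp add: gram_def)

lemma diag_simps:
  "diag [] = 0" "diag ((f, g, b) # xs) = (\<lambda>x. tens (f x) (g x *\<^sub>C b)) + diag xs"
  "diag (xs @ ys) = diag xs + diag ys"
  by (simp_all add: diag_def)

lemma gram_commute: "xs \<in> triples \<Longrightarrow> ys \<in> triples \<Longrightarrow> gram xs ys = cnj (gram ys xs)"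
proof (induction xs)
  case (Cons x xs)
  obtain f g b where x: "x = (f, g, b)" by (cases x)
  have fg: "f \<in> E1.S" "g \<in> k2.S" using Cons.prems x by simp_all
  have "gram [x] ys = cnj (gram ys [x])"
    using Cons.prems(2)
  proof (induction ys)
    case (Cons y ys)
    obtain f' g' b' where y: "y = (f', g', b')" by (cases y)
    have fg': "f' \<in> E1.S" "g' \<in> k2.S" using Cons.prems y by simp_all
    have "gram [x] [y] = cnj (gram [y] [x])"
      unfolding x y gram_singleton complex_cnj_mult
      using E1.ip_commute[OF fg(1) fg'(1)] k2.ip_commute[OF fg(2) fg'(2)] cinner_commute[of b b']
      by (rule arg_cong2[OF arg_cong2])
    thus ?case
      unfolding gram_Cons_left[of y ys] gram_Cons_right[of "[x]" y ys] using Cons y by simp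
  qed simp
  thus ?case
    unfolding gram_Cons_left[of x xs] gram_Cons_right[of ys x xs] using Cons x by simp
qed simp

text \<open>The Gram matrices of the second and third components are both factored; their entrywise
  product is then factored over pairs of indices, and \<open>gram_schur\<close> for the first
  component gives a sum of squares.\<close>

lemma gram_self_nonneg:
  assumes xs: "xs \<in> triples"
  shows "0 \<le> Re (gram xs xs)"
proof -
  define n where "n = length xs"
  define f g b where "f i = fst (xs ! i)" and "g i = fst (snd (xs ! i))"
    and "b i = snd (snd (xs ! i))" for i
  have mem: "f i \<in> E1.S" "g i \<in> k2.S" if "i < n" for i
  proof -
    have "xs ! i \<in> E1.S \<times> k2.S \<times> UNIV"
      using xs nth_mem[of i xs] that unfolding triples_def n_def by blast
    thus "f i \<in> E1.S" "g i \<in> k2.S"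
      by (simp_all add: mem_Times_iff f_def g_def)
  qed
  obtain u :: "nat \<Rightarrow> nat \<Rightarrow> complex"
    where u: "\<forall>i<n. \<forall>j<n. k2.ip (g i) (g j) = (\<Sum>k<n. u k i * cnj (u k j))"
    using k2.gram_factorization[of n g] mem(2) by blast
  obtain v :: "nat \<Rightarrow> nat \<Rightarrow> complex"
    where v: "\<forall>i<n. \<forall>j<n. cinner (b i) (b j) = (\<Sum>k<n. v k i * cnj (v k j))"
    using hilbert_type.gram_factorization[of n b] by auto
  define w where "w k i = u (fst k) i * v (snd k) i" for k :: "nat \<times> nat" and i
  have "gram xs xs =
      (\<Sum>i<n. \<Sum>j<n. E1.ip (f i) (f j) * (k2.ip (g i) (g j) * cinner (b i) (b j)))"
    by (simp add: gram_def sum_list_sum_nth atLeast0LessThan case_prod_beta n_def f_def g_def b_def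
        mult.assoc)
  also have "\<dots> = (\<Sum>i<n. \<Sum>j<n. E1.ip (f i) (f j) *
      (\<Sum>k\<in>{..<n} \<times> {..<n}. w k i * cnj (w k j)))"
    using u v
    by (intro sum.cong refl)
      (simp add: w_def sum_product sum.cartesian_product case_prod_beta mult_ac)
  also have "\<dots> = complex_of_real
      (\<Sum>k\<in>{..<n} \<times> {..<n}. (E1.N (\<Sum>i<n. w k i *\<^sub>C f i))\<^sup>2)"
    by (rule E1.gram_schur) (rule mem)
  finally show ?thesis
    by (simp add: sum_nonneg del: of_real_sum)
qed

section \<open>Finite sums of kernel functions, and restriction as a contraction\<close>

definition elem :: "('l \<times> 'a \<times> 'b) list \<Rightarrow> 'l \<Rightarrow> 'c" where
  "elem zs = (\<Sum>(y, a, b)\<leftarrow>zs. P.ker y (tens a b))"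

text \<open>The adjoint of restriction, evaluated on \<open>elem zs\<close>: a kernel function of
  the product comes from the tensor of the kernel functions at the same point.\<close>

definition lift :: "('l \<times> 'a \<times> 'b) list \<Rightarrow> ('l, 'a, 'b) triples" where
  "lift zs = map (\<lambda>(y, a, b). (E1.ker y a, k2.ker y 1, b)) zs"

lemma elem_simps:
  "elem [] = 0" "elem ((y, a, b) # zs) = P.ker y (tens a b) + elem zs"
  "elem (zs @ zs') = elem zs + elem zs'"
  by (simp_all add: elem_def)

lemma elem_mem [simp]: "elem zs \<in> P.S"
  by (induction zs) (auto simp: elem_simps)

lemma lift_mem [simp]: "lift zs \<in> triples"
  by (induction zs) (auto simp: lift_def)

lemma diag_lift: "diag (lift zs) = elem zs"
proof (induction zs)
  case (Cons z zs)
  obtain y a b where z: "z = (y, a, b)" by (cases z)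
  have "lift (z # zs) = (E1.ker y a, k2.ker y 1, b) # lift zs"
    by (simp add: lift_def z)
  thus ?case
    using Cons
    by (simp add: z diag_simps elem_simps tens_scale_left tens_scale_right scaleC_scaleC
        scaleC_complex_def mult.commute)
qed (simp add: lift_def diag_simps elem_simps)

text \<open>The two factors reproduce at \<open>y\<close> independently, and inner products of
  elementary tensors are products.\<close>

lemma cinner_diag_tens:
  assumes "xs \<in> triples"
  shows "cinner (diag xs y) (tens a b) = gram xs [(E1.ker y a, k2.ker y 1, b)]"
  using assms
proof (induction xs)
  case (Cons x xs)
  obtain f g c where x: "x = (f, g, c)" by (cases x)
  thus ?case
    using Cons
    by (subst gram_Cons_left)
      (simp add: diag_simps plus_fun_apply gram_singleton hilbert_type.ip_add_left tens_scale_right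
        hilbert_type.ip_scale_left cinner_tens E1.reproducing k2.reproducing cinner_complex_def)
qed (simp add: diag_simps zero_fun_apply)

text \<open>Adjointness of \<open>lift\<close> and \<open>diag\<close>. Membership of
  \<open>diag xs\<close> is a premise, as it is established only for the restrictions that
  occur.\<close>

lemma gram_lift:
  assumes "xs \<in> triples" "diag xs \<in> P.S"
  shows "gram xs (lift zs) = P.ip (diag xs) (elem zs)"
proof (induction zs)
  case Nil
  show ?case using assms by (simp add: lift_def elem_simps)
next
  case (Cons z zs)
  obtain y a b where z: "z = (y, a, b)" by (cases z)
  have "lift (z # zs) = (E1.ker y a, k2.ker y 1, b) # lift zs"
    by (simp add: lift_def z)
  thus ?case
    using Cons assms
    by (simp add: z elem_simps gram_Cons_right[of xs _ "lift zs"] P.ip_add_right P.reproducing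
        cinner_diag_tens)
qed

lemma elem_scale: "\<exists>zs'. elem zs' = c *\<^sub>C elem zs"
proof (induction zs)
  case Nil
  show ?case by (rule exI[of _ "[]"]) (simp add: elem_simps)
next
  case (Cons z zs)
  obtain y a b where z: "z = (y, a, b)" by (cases z)
  obtain zs' where "elem zs' = c *\<^sub>C elem zs" using Cons by blast
  hence "elem ((y, c *\<^sub>C a, b) # zs') = c *\<^sub>C elem (z # zs)"
    by (simp add: z elem_simps scaleC_add_right tens_scale_left)
      (simp add: scaleC_fun_def scaleC_scaleC mult_ac)
  thus ?case by blast
qed

text \<open>A kernel function depends boundedly on its vector, and sums of elementary tensors
  approximate \<zeta>.\<close>

lemma elem_dense_ker:
  assumes "e > 0"
  shows "\<exists>zs. P.N (P.ker y \<zeta> - elem zs) < e"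
proof -
  \<comment> \<open>The kernel may still vanish at \<open>(y, y)\<close> here; the added 1 allows
    division by \<open>C\<close>.\<close>
  define C where "C = sqrt (cmod (k1 y y * k2 y y)) + 1"
  have C: "C > 0" by (simp add: C_def add_nonneg_pos)
  have "\<zeta> \<in> closure (complex_vector.span {tens a b | a b. True})"
    using closure_span_tens by simp
  then obtain \<zeta>' where \<zeta>': "\<zeta>' \<in> complex_vector.span {tens a b | a b. True}" "dist \<zeta>' \<zeta> < e / C"
    using C assms unfolding closure_approachable by (meson divide_pos_pos)
  obtain ps where ps: "\<zeta>' = (\<Sum>(a, b)\<leftarrow>ps. tens a b)"
    using span_tens_sum_list[OF \<zeta>'(1)] by blast
  have ker: "elem (map (\<lambda>(a, b). (y, a, b)) ps) = P.ker y \<zeta>'"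
    unfolding ps
    by (induction ps) (auto simp: elem_simps fun_eq_iff plus_fun_apply zero_fun_apply scaleC_add_right)
  have "P.N (P.ker y \<zeta> - P.ker y \<zeta>') = P.N (P.ker y (\<zeta> - \<zeta>'))"
    by (rule arg_cong[where f = P.N])
      (simp add: fun_eq_iff complex_vector.scale_right_diff_distrib)
  also have "\<dots> \<le> sqrt (cmod (k1 y y * k2 y y)) * norm (\<zeta> - \<zeta>')"
    by (rule P.N_ker_le)
  also have "\<dots> \<le> C * norm (\<zeta> - \<zeta>')"
    by (intro mult_right_mono) (simp_all add: C_def)
  also have "\<dots> < e"
    using \<zeta>'(2) C by (simp add: dist_norm norm_minus_commute pos_less_divide_eq mult.commute)
  finally show ?thesis unfolding ker[symmetric] by blast
qed

lemma elem_dense: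
  assumes h: "h \<in> P.S" and e: "e > 0"
  shows "\<exists>zs. P.N (h - elem zs) < e"
proof -
  have "G \<in> P.S \<and> (\<forall>e>0. \<exists>zs. P.N (G - elem zs) < e)" if "G \<in> P.ker_span" for G
    using that
  proof (induction rule: complex_vector.span_induct_alt)
    case base
    show ?case
      by (intro conjI allI impI exI[of _ "[]"])
        (simp_all only: elem_simps diff_self P.zero_mem P.N_zero)
  next
    case (step c g G)
    then obtain y \<zeta> where g: "g = P.ker y \<zeta>" by auto
    have mem: "g \<in> P.S" "G \<in> P.S" using step.IH by (simp_all add: g)
    have "\<exists>zs. P.N (c *\<^sub>C g + G - elem zs) < e" if e: "e > 0" for e
    proof -
      have c: "cmod c + 1 > 0" by (simp add: add_nonneg_pos)
      obtain zs where zs: "P.N (g - elem zs) < e / 2 / (cmod c + 1)"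
        using elem_dense_ker[of "e / 2 / (cmod c + 1)" y \<zeta>] c e g by auto
      obtain zs' where zs': "P.N (G - elem zs') < e / 2"
        using step.IH e half_gt_zero by blast
      obtain zs'' where zs'': "elem zs'' = c *\<^sub>C elem zs"
        using elem_scale by blast
      have "P.N (c *\<^sub>C g + G - elem (zs'' @ zs')) = P.N (c *\<^sub>C (g - elem zs) + (G - elem zs'))"
        by (rule arg_cong[where f = P.N])
          (simp add: elem_simps zs'' complex_vector.scale_right_diff_distrib)
      also have "\<dots> \<le> P.N (c *\<^sub>C (g - elem zs)) + P.N (G - elem zs')"
        using mem by (intro P.N_triangle) simp_all
      also have "P.N (c *\<^sub>C (g - elem zs)) \<le> (cmod c + 1) * P.N (g - elem zs)"
        using mem by (simp add: P.N_scale mult_right_mono)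
      also have "\<dots> < e / 2"
        using zs c by (simp add: pos_less_divide_eq algebra_simps)
      finally show ?thesis using zs' by (intro exI[of _ "zs'' @ zs'"]) linarith
    qed
    thus ?case using mem P.add_mem P.scale_mem by blast
  qed
  moreover obtain G where "G \<in> P.ker_span" "P.N (h - G) < e / 2"
    using P.dense_ker_span h half_gt_zero[OF e] unfolding dense_in_def by blast
  ultimately obtain zs where "G \<in> P.S" "P.N (h - G) < e / 2" "P.N (G - elem zs) < e / 2"
    using half_gt_zero[OF e] by blast
  thus ?thesis
    using P.N_triangle_diff[OF h, of G "elem zs"] by (intro exI[of _ zs]) simp
qed

text \<open>Positivity of \<open>gram\<close>, applied to \<open>xs\<close> together with a finite sum of kernel functions that
  approximates \<open>- diag xs\<close>.\<close>

lemma diag_norm_le: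
  assumes xs: "xs \<in> triples" and h: "diag xs \<in> P.S"
  shows "(P.N (diag xs))\<^sup>2 \<le> Re (gram xs xs)"
proof (rule field_le_epsilon)
  fix e :: real
  assume e: "e > 0"
  have "sqrt e > 0" "- diag xs \<in> P.S" using e h by simp_all
  then obtain zs where "P.N (- diag xs - elem zs) < sqrt e"
    using elem_dense by blast
  moreover have "P.N (- diag xs - elem zs) = P.N (diag xs + elem zs)"
    using P.N_scale[of "diag xs + elem zs" "- 1"] h by (simp add: minus_diff_commute)
  ultimately have "(P.N (diag xs + elem zs))\<^sup>2 \<le> e"
    using h e by (metis P.N_nonneg P.add_mem elem_mem less_imp_le real_sqrt_le_iff real_sqrt_abs abs_of_nonneg)
  \<comment> \<open>By adjointness only \<open>gram xs xs\<close> fails to be an inner product in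
    \<open>P.S\<close>. So this expansion exceeds the squared norm of
    \<open>diag xs + elem zs\<close>, which is at most \<open>e\<close>, by exactly
    \<open>gram xs xs\<close> minus the squared norm of \<open>diag xs\<close>.\<close>
  moreover have "gram (xs @ lift zs) (xs @ lift zs) =
      gram xs xs + P.ip (diag xs) (elem zs) + cnj (P.ip (diag xs) (elem zs)) + P.ip (elem zs) (elem zs)"
    using gram_commute[OF lift_mem xs, of zs] gram_lift[OF lift_mem, of zs zs]
    by (simp add: gram_append gram_lift[OF xs h] diag_lift)
  hence "Re (gram (xs @ lift zs) (xs @ lift zs)) =
      Re (gram xs xs) + 2 * Re (P.ip (diag xs) (elem zs)) + (P.N (elem zs))\<^sup>2"
    by (simp add: P.N_square)
  moreover have "0 \<le> Re (gram (xs @ lift zs) (xs @ lift zs))"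
    using xs by (intro gram_self_nonneg) simp
  moreover have "(P.N (diag xs + elem zs))\<^sup>2 =
      (P.N (diag xs))\<^sup>2 + 2 * Re (P.ip (diag xs) (elem zs)) + (P.N (elem zs))\<^sup>2"
    using h by (intro P.N_add_square) simp_all
  ultimately show "(P.N (diag xs))\<^sup>2 \<le> Re (gram xs xs) + e"
    by linarith
qed

section \<open>Orthogonality to everything that vanishes on the diagonal\<close>

definition scale :: "complex \<Rightarrow> ('l, 'a, 'b) triples \<Rightarrow> ('l, 'a, 'b) triples" where
  "scale t ys = map (\<lambda>(f, g, b). (t *\<^sub>C f, g, b)) ys"

lemma scale_mem: "ys \<in> triples \<Longrightarrow> scale t ys \<in> triples"
  by (induction ys) (auto simp: scale_def)

lemma gram_scale_right:
  assumes "xs \<in> triples" "ys \<in> triples"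
  shows "gram xs (scale t ys) = cnj t * gram xs ys"
  using assms(2)
proof (induction ys)
  case (Cons y ys)
  obtain f g b where y: "y = (f, g, b)" by (cases y)
  have f: "f \<in> E1.S" using Cons.prems y by simp
  have "gram xs [(t *\<^sub>C f, g, b)] = cnj t * gram xs [(f, g, b)]"
    using assms(1)
  proof (induction xs)
    case (Cons x xs)
    obtain f' g' b' where x: "x = (f', g', b')" by (cases x)
    show ?case
      unfolding gram_Cons_left[of x xs]
      using Cons f x by (simp add: gram_singleton E1.ip_scale_right algebra_simps)
  qed simp
  moreover have "scale t (y # ys) = (t *\<^sub>C f, g, b) # scale t ys"
    by (simp add: scale_def y)
  ultimately show ?case
    unfolding gram_Cons_right[of xs y ys] using Cons y
    by (simp add: gram_Cons_right[of xs _ "scale t ys"] algebra_simps)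
qed (simp add: scale_def)

lemma diag_scale: "diag (scale t ys) = t *\<^sub>C diag ys"
proof (induction ys)
  case (Cons y ys)
  obtain f g b where y: "y = (f, g, b)" by (cases y)
  have "scale t (y # ys) = (t *\<^sub>C f, g, b) # scale t ys"
    by (simp add: scale_def y)
  thus ?case
    using Cons
    by (simp add: diag_simps y scaleC_add_right)
      (simp add: scaleC_fun_def tens_scale_left)
qed (simp add: scale_def diag_simps)

text \<open>All perturbations of \<open>xs\<close> by multiples of \<open>ys\<close> have the same restriction to the diagonal, so
  none of them is shorter than \<open>xs\<close>.\<close>

lemma gram_orthogonal:
  assumes xs: "xs \<in> triples" "diag xs \<in> P.S" "Re (gram xs xs) \<le> (P.N (diag xs))\<^sup>2"
    and ys: "ys \<in> triples" "diag ys = 0"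
  shows "gram xs ys = 0"
proof (rule ccontr)
  define w c where "w = gram xs ys" and "c = Re (gram ys ys)"
  assume "gram xs ys \<noteq> 0"
  hence w: "cmod w > 0" by (simp add: w_def)
  have c: "c \<ge> 0" using gram_self_nonneg[OF ys(1)] by (simp add: c_def)
  \<comment> \<open>The perturbation \<open>t\<close> points against \<open>w\<close>, so its linear
    term is -2 r |w|^2. With r c at most 1 the quadratic term is at most r |w|^2 and cannot
    compensate; \<open>c + 1\<close> avoids dividing by zero.\<close>
  define r where "r = 1 / (c + 1)"
  have r: "r > 0" "r * c \<le> 1" using c by (simp_all add: r_def)
  define t where "t = - (complex_of_real r * w)"
  have syx: "scale t ys \<in> triples" using ys scale_mem by blast
  have "diag (xs @ scale t ys) = diag xs"
    by (simp add: diag_simps diag_scale ys(2))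
  hence "(P.N (diag xs))\<^sup>2 \<le> Re (gram (xs @ scale t ys) (xs @ scale t ys))"
    using diag_norm_le[of "xs @ scale t ys"] xs syx by simp
  also have "gram (xs @ scale t ys) (xs @ scale t ys) =
      gram xs xs + cnj t * w + cnj (cnj t * w) + t * cnj t * gram ys ys"
  proof -
    have "gram (scale t ys) xs = cnj (cnj t * w)"
      using gram_commute[OF syx xs(1)] gram_scale_right[OF xs(1) ys(1)] by (simp add: w_def)
    moreover have "gram (scale t ys) (scale t ys) = t * cnj t * gram ys ys"
      using gram_scale_right[OF syx ys(1), of t] gram_commute[OF syx ys(1)]
        gram_scale_right[OF ys(1) ys(1), of t] gram_commute[OF ys(1) ys(1)]
      by simp
    ultimately show ?thesis
      using gram_scale_right[OF xs(1) ys(1), of t] by (simp add: gram_append w_def)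
  qed
  also have "Re \<dots> = Re (gram xs xs) - 2 * r * (cmod w)\<^sup>2 + r\<^sup>2 * (cmod w)\<^sup>2 * c"
  proof -
    have "cnj t * w = complex_of_real (- r * (cmod w)\<^sup>2)"
      using complex_norm_square[of w] by (simp add: t_def mult_ac)
    moreover have "t * cnj t = complex_of_real (r\<^sup>2 * (cmod w)\<^sup>2)"
      using complex_norm_square[of w] by (simp add: t_def power2_eq_square mult_ac)
    ultimately show ?thesis by (simp only: c_def) simp
  qed
  finally have "2 * r * (cmod w)\<^sup>2 \<le> r\<^sup>2 * (cmod w)\<^sup>2 * c"
    using xs(3) by linarith
  also have "\<dots> = (r * c) * (r * (cmod w)\<^sup>2)"
    by (simp add: power2_eq_square mult_ac)
  also have "\<dots> \<le> 1 * (r * (cmod w)\<^sup>2)"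
    using r by (intro mult_right_mono) simp_all
  finally show False using r w by simp
qed

end

section \<open>Isometric multipliers\<close>

lemma times_id_eq: "times_id k x y = (\<lambda>\<eta>. k x y *\<^sub>C \<eta>)"
  by (simp add: fun_eq_iff times_id_def)

lemma rkhs_times_idI: "rkhs (times_id k) H \<Longrightarrow> rkhs_times_id k H"
  by (simp add: rkhs_times_id_def rkhs_times_id_axioms_def hilbert_carrier_def rkhs_def)

text \<open>\<open>contractive\<close> is the form in which norm preservation is used. The fixed
  vector \<open>\<xi>\<close> fills the third tensor slot throughout; nonvanishing of the product
  kernel provides it.\<close>

locale isometric_multiplier =
  kernel_product k1 k2 H1 H2 H tens + scalar_vector_rkhs k1 Hk1 H1
  for k1 k2 :: "'l \<Rightarrow> 'l \<Rightarrow> complex"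
    and H1 :: "('l \<Rightarrow> 'a::complex_hilbert) inner_space"
    and Hk1 H2 :: "('l \<Rightarrow> complex) inner_space"
    and H :: "('l \<Rightarrow> 'c::complex_hilbert) inner_space"
    and tens :: "'a \<Rightarrow> 'b::complex_hilbert \<Rightarrow> 'c" +
  fixes \<phi> :: "'l \<Rightarrow> 'a \<Rightarrow> 'a" and \<xi> :: 'b
  assumes multiplier: "\<phi> \<in> multipliers H1"
    and contractive: "f \<in> hcarrier H1 \<Longrightarrow> hnorm H1 (mult_op \<phi> f) \<le> hnorm H1 f"
    and isometric: "isometry_on H (mult_op (mult_tensor_id tens \<phi>))"
    and dense: "dense_in (hcarrier Hk1 \<inter> hcarrier H2) Hk1"
    and \<xi>: "\<xi> \<noteq> 0"
    and diagonal: "k1 x x \<noteq> 0" "k2 x x \<noteq> 0"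
begin

definition image :: "'l \<Rightarrow> 'a \<Rightarrow> 'l \<Rightarrow> 'a" where
  "image l \<eta> = mult_op \<phi> (E1.ker l \<eta>)"

lemma image_mem [simp]: "image l \<eta> \<in> E1.S"
  by (simp add: image_def E1.multipliers_mem[OF multiplier])

lemma image_apply: "image l \<eta> z = k1 z l *\<^sub>C \<phi> z \<eta>"
  using E1.multipliers_bounded[OF multiplier] by (simp add: image_def mult_op_def bounded_clinear_def)

definition image_triple :: "'l \<Rightarrow> 'a \<Rightarrow> ('l, 'a, 'b) triples" where
  "image_triple l \<eta> = [(image l \<eta>, k2.ker l 1, \<xi>)]"

text \<open>Each \<open>\<phi> z\<close> is linear and acts on the first factor only, so the scalar
  \<open>k2 z l\<close> and the vector \<open>\<xi>\<close> pass through; the restriction is thus an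
  image under the isometry.\<close>

lemma diag_image_triple:
  "diag (image_triple l \<eta>) = mult_op (mult_tensor_id tens \<phi>) (P.ker l (tens \<eta> \<xi>))"
proof
  fix z
  have \<phi>: "bounded_clinear (\<phi> z)" by (rule E1.multipliers_bounded[OF multiplier])
  have "mult_op (mult_tensor_id tens \<phi>) (P.ker l (tens \<eta> \<xi>)) z =
      op_tensor tens (\<phi> z) id (tens ((k1 z l * k2 z l) *\<^sub>C \<eta>) \<xi>)"
    by (simp add: mult_op_def mult_tensor_id_def tens_scale_left)
  also have "\<dots> = (k1 z l * k2 z l) *\<^sub>C tens (\<phi> z \<eta>) \<xi>"
    unfolding op_tensor_id[OF \<phi>] using \<phi> by (simp add: bounded_clinear_def tens_scale_left)
  also have "\<dots> = diag (image_triple l \<eta>) z"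
    by (simp add: image_triple_def diag_simps image_apply tens_scale_left tens_scale_right
        scaleC_scaleC scaleC_complex_def mult.commute)
  finally show "diag (image_triple l \<eta>) z =
      mult_op (mult_tensor_id tens \<phi>) (P.ker l (tens \<eta> \<xi>)) z" by simp
qed

lemma diag_image_triple_mem: "diag (image_triple l \<eta>) \<in> P.S"
  and N_diag_image_triple: "P.N (diag (image_triple l \<eta>)) = P.N (P.ker l (tens \<eta> \<xi>))"
  using isometric unfolding diag_image_triple isometry_on_def by simp_all

lemma image_triple_mem: "image_triple l \<eta> \<in> triples"
  by (simp only: image_triple_def triples_simps image_mem k2.ker_mem simp_thms)

text \<open>Norms of elementary tensors multiply, also for the kernel function of the product. Hence
  contractivity in the first component is all that is to be compared.\<close>

lemma gram_image_triple_le: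
  "Re (gram (image_triple l \<eta>) (image_triple l \<eta>)) \<le> (P.N (diag (image_triple l \<eta>)))\<^sup>2"
proof -
  have "complex_of_real ((P.N (P.ker l (tens \<eta> \<xi>)))\<^sup>2) =
      complex_of_real ((E1.N (E1.ker l \<eta>))\<^sup>2 * (k2.N (k2.ker l 1))\<^sup>2 * (norm \<xi>)\<^sup>2)"
    unfolding of_real_mult E1.N_ker k2.N_ker P.N_ker norm_tens power_mult_distrib by simp
  hence N: "(P.N (P.ker l (tens \<eta> \<xi>)))\<^sup>2 =
      (E1.N (E1.ker l \<eta>))\<^sup>2 * (k2.N (k2.ker l 1))\<^sup>2 * (norm \<xi>)\<^sup>2"
    by (simp only: of_real_eq_iff)
  have "Re (gram (image_triple l \<eta>) (image_triple l \<eta>)) =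
      (E1.N (image l \<eta>))\<^sup>2 * (k2.N (k2.ker l 1))\<^sup>2 * (norm \<xi>)\<^sup>2"
    unfolding image_triple_def gram_singleton E1.ip_self[OF image_mem] k2.ip_self[OF k2.ker_mem]
      cinner_self
    by (simp only: of_real_mult[symmetric] Re_complex_of_real)
  also have "\<dots> \<le> (E1.N (E1.ker l \<eta>))\<^sup>2 * (k2.N (k2.ker l 1))\<^sup>2 * (norm \<xi>)\<^sup>2"
    unfolding image_def
    by (intro mult_right_mono power_mono contractive E1.ker_mem zero_le_power2
        E1.N_nonneg E1.multipliers_mem[OF multiplier])
  finally show ?thesis unfolding N_diag_image_triple N .
qed

text \<open>The triples \<open>f a \<otimes> g \<otimes> \<xi> - g a \<otimes> f \<otimes> \<xi>\<close> vanish on the diagonal.\<close>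

lemma ip_image_symmetric:
  assumes f: "f \<in> sc.S" "f \<in> k2.S" and g: "g \<in> sc.S" "g \<in> k2.S"
  shows "E1.ip (image l \<eta>) (vmul f a) * cnj (g l) = E1.ip (image l \<eta>) (vmul g a) * cnj (f l)"
proof -
  define ys where "ys = [(vmul f a, g, \<xi>), (- 1 *\<^sub>C vmul g a, f, \<xi>)]"
  have ys: "ys \<in> triples"
    unfolding ys_def triples_simps
    by (intro conjI vmul_mem_norm(1) E1.scale_mem f g triples_simps(1))
  have "diag ys x = 0" for x
    unfolding ys_def diag_simps
    by (simp add: plus_fun_apply zero_fun_apply tens_scale_left tens_scale_right tens_minus_left
        scaleC_fun_def scaleC_scaleC mult.commute)
  hence diag: "diag ys = 0" by (simp add: fun_eq_iff zero_fun_apply)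
  \<comment> \<open>The second component of \<open>image_triple\<close> is a kernel function;
    pairing with it produces the values at \<open>l\<close>.\<close>
  have k2: "k2.ip (k2.ker l 1) u = cnj (u l)" if "u \<in> k2.S" for u
    using k2.ip_commute[OF k2.ker_mem that] k2.reproducing[OF that, of l 1]
    by (simp add: cinner_complex_def)
  have "gram (image_triple l \<eta>) ys =
      (E1.ip (image l \<eta>) (vmul f a) * cnj (g l) - E1.ip (image l \<eta>) (vmul g a) * cnj (f l)) *
      cinner \<xi> \<xi>"
    unfolding ys_def image_triple_def gram_Cons_right[of _ _ "[_]"] gram_singleton
      E1.ip_scale_right[OF image_mem vmul_mem_norm(1)[OF g(1)]] k2[OF f(2)] k2[OF g(2)]
    by (simp add: algebra_simps)
  moreover have "gram (image_triple l \<eta>) ys = 0"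
    by (rule gram_orthogonal[OF image_triple_mem diag_image_triple_mem gram_image_triple_le ys diag])
  moreover have "cinner \<xi> \<xi> \<noteq> 0"
    using \<xi> by (simp add: cinner_self)
  ultimately show ?thesis by simp
qed

text \<open>By \<open>ip_image_symmetric\<close> one \<open>g\<close> with
  \<open>g l \<noteq> 0\<close> determines the ratio for all \<open>f\<close> in the intersection;
  density and continuity of both sides extend it to the whole scalar space.\<close>

lemma ip_image:
  obtains c where "\<And>f. f \<in> sc.S \<Longrightarrow> E1.ip (image l \<eta>) (vmul f a) = c * cnj (f l)"
proof -
  obtain X where X: "\<And>n. X n \<in> sc.S \<inter> k2.S" "\<And>n. X n \<in> sc.S"
      "(\<lambda>n. sc.N (X n - sc.ker l 1)) \<longlonglongrightarrow> 0"
    using sc.dense_in_sequence[OF dense sc.ker_mem] by blast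
  \<comment> \<open>Such a \<open>g\<close> exists because the kernel function at \<open>l\<close>,
    nonzero at \<open>l\<close>, is a limit from the intersection.\<close>
  have "\<exists>n. X n l \<noteq> 0"
  proof (rule ccontr)
    assume "\<not> ?thesis"
    moreover have "(\<lambda>n. X n l) \<longlonglongrightarrow> k1 l l *\<^sub>C 1"
      by (rule sc.tendsto_eval[OF X(2) sc.ker_mem X(3)])
    ultimately have "(\<lambda>n. 0) \<longlonglongrightarrow> k1 l l *\<^sub>C (1::complex)"
      by simp
    thus False using diagonal by (simp add: scaleC_complex_def LIMSEQ_const_iff)
  qed
  then obtain g where g: "g \<in> sc.S" "g \<in> k2.S" "g l \<noteq> 0" using X(1) by blast
  define c where "c = E1.ip (image l \<eta>) (vmul g a) / cnj (g l)"
  have "E1.ip (image l \<eta>) (vmul f a) = c * cnj (f l)" if f: "f \<in> sc.S" for f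
  proof -
    obtain Y where Y: "\<And>n. Y n \<in> sc.S \<inter> k2.S" "\<And>n. Y n \<in> sc.S" "(\<lambda>n. sc.N (Y n - f)) \<longlonglongrightarrow> 0"
      using sc.dense_in_sequence[OF dense f] by blast
    have "E1.N (vmul (Y n) a - vmul f a) = sc.N (Y n - f) * norm a" for n
      using vmul_mem_norm(2)[OF sc.diff_mem[OF Y(2) f]] unfolding vmul_linear .
    moreover have "(\<lambda>n. sc.N (Y n - f) * norm a) \<longlonglongrightarrow> 0"
      using Y(3) by (rule tendsto_mult_left_zero)
    ultimately have "(\<lambda>n. E1.ip (image l \<eta>) (vmul (Y n) a)) \<longlonglongrightarrow> E1.ip (image l \<eta>) (vmul f a)"
      by (intro E1.tendsto_ip_right[OF vmul_mem_norm(1)[OF Y(2)] vmul_mem_norm(1)[OF f] _ image_mem])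
        simp
    moreover have "E1.ip (image l \<eta>) (vmul (Y n) a) = c * cnj (Y n l)" for n
      using ip_image_symmetric[of "Y n" g l \<eta> a] Y(1)[of n] g by (simp add: c_def divide_simps)
    moreover have "(\<lambda>n. c * cnj (Y n l)) \<longlonglongrightarrow> c * cnj (f l)"
      by (intro tendsto_intros sc.tendsto_eval[OF Y(2) f Y(3)])
    ultimately show ?thesis using LIMSEQ_unique by simp
  qed
  thus ?thesis using that by blast
qed

text \<open>Applying \<open>ip_image\<close> to the kernel function at x makes every component of
  the image a multiple of \<open>k1 x l\<close>; evaluation at x = l fixes the factor, as
  \<open>k1 l l\<close> is nonzero.\<close>

lemma image_eq_ker: "image l \<eta> = E1.ker l (\<phi> l \<eta>)"
proof
  fix z
  have "cinner (image l \<eta> z) a = cinner (k1 z l *\<^sub>C \<phi> l \<eta>) a" for a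
  proof -
    obtain c where c: "\<And>f. f \<in> sc.S \<Longrightarrow> E1.ip (image l \<eta>) (vmul f a) = c * cnj (f l)"
      using ip_image[of l \<eta> a] by blast
    have main: "cinner (image l \<eta> x) a = c * k1 x l" for x
    proof -
      have "vmul (sc.ker x 1) a = E1.ker x a"
        by (simp add: scaleC_complex_def)
      hence "cinner (image l \<eta> x) a = c * cnj (k1 l x)"
        using c[OF sc.ker_mem[of x 1]] E1.reproducing[OF image_mem, of l \<eta> x a]
        by (simp add: scaleC_complex_def)
      also have "cnj (k1 l x) = k1 x l"
        using sc.ip_commute[OF sc.ker_mem[of l 1] sc.ker_mem[of x 1]]
        unfolding sc.ip_ker by (simp add: cinner_complex_def)
      finally show ?thesis .
    qed
    have "c = cinner (\<phi> l \<eta>) a"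
      using main[of l] diagonal(1)[of l] by (simp add: image_apply hilbert_type.ip_scale_left)
    thus ?thesis using main[of z] by (simp add: hilbert_type.ip_scale_left)
  qed
  hence "cinner (image l \<eta> z - k1 z l *\<^sub>C \<phi> l \<eta>) a = 0" for a
    by (simp add: hilbert_type.ip_diff_left)
  from this[of "image l \<eta> z - k1 z l *\<^sub>C \<phi> l \<eta>"] show "image l \<eta> z = k1 z l *\<^sub>C \<phi> l \<eta>"
    unfolding cinner_self by simp
qed

lemma multiplier_eq:
  assumes "k1 z l \<noteq> 0"
  shows "\<phi> z = \<phi> l"
proof
  fix \<eta>
  have "k1 z l *\<^sub>C \<phi> z \<eta> = k1 z l *\<^sub>C \<phi> l \<eta>"
    using fun_cong[OF image_eq_ker, of l \<eta> z] unfolding image_apply .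
  thus "\<phi> z \<eta> = \<phi> l \<eta>" using assms by simp
qed

text \<open>The isometry sends the kernel function for \<open>tens \<eta> \<xi>\<close> to the one
  for \<open>tens (\<phi> l \<eta>) \<xi>\<close> at the same point; the diagonal values and the
  norm of \<open>\<xi>\<close> cancel.\<close>

lemma multiplier_isometry: "isometry (\<phi> l)"
  unfolding isometry_def
proof (intro conjI allI)
  show "bounded_clinear (\<phi> l)" by (rule E1.multipliers_bounded[OF multiplier])
  fix \<eta>
  have "diag (image_triple l \<eta>) = P.ker l (tens (\<phi> l \<eta>) \<xi>)"
    unfolding image_triple_def image_eq_ker diag_simps
    by (simp add: fun_eq_iff tens_scale_left tens_scale_right scaleC_scaleC scaleC_complex_def
        mult.commute)
  hence "P.N (P.ker l (tens (\<phi> l \<eta>) \<xi>)) = P.N (P.ker l (tens \<eta> \<xi>))"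
    using N_diag_image_triple[of l \<eta>] by simp
  hence "k1 l l * k2 l l * complex_of_real ((norm (tens (\<phi> l \<eta>) \<xi>))\<^sup>2) =
      k1 l l * k2 l l * complex_of_real ((norm (tens \<eta> \<xi>))\<^sup>2)"
    by (simp only: P.N_ker[symmetric])
  thus "norm (\<phi> l \<eta>) = norm \<eta>"
    using diagonal[of l] \<xi> by (simp add: norm_tens power_mult_distrib flip: of_real_power)
qed

end

theorem theorem5p1:
  fixes k1 k2 :: "'l \<Rightarrow> 'l \<Rightarrow> complex"
    and tens :: "'a::complex_hilbert \<Rightarrow> 'b::complex_hilbert \<Rightarrow> 'c::complex_hilbert"
    and K1 :: "'l \<Rightarrow> 'l \<Rightarrow> 'a \<Rightarrow> 'a"
    and K2 :: "'l \<Rightarrow> 'l \<Rightarrow> 'b \<Rightarrow> 'b"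
    and K :: "'l \<Rightarrow> 'l \<Rightarrow> 'c \<Rightarrow> 'c"
    and Hk1 Hk2 :: "('l \<Rightarrow> complex) inner_space"
    and HK1 :: "('l \<Rightarrow> 'a) inner_space"
    and HK :: "('l \<Rightarrow> 'c) inner_space"
    and \<phi> :: "'l \<Rightarrow> 'a \<Rightarrow> 'a"
  assumes kernel1: "kernel (scalar_kernel k1)" "nonvanishing (scalar_kernel k1)"
    and kernel2: "kernel (scalar_kernel k2)" "nonvanishing (scalar_kernel k2)"
    and tensor: "hilbert_tensor tens"
    and K1: "K1 = times_id k1"
    and K2: "K2 = times_id k2"
    and K: "K = kernel_prod tens K1 K2" "nonvanishing K"
    and Hk1: "rkhs (scalar_kernel k1) Hk1"
    and Hk2: "rkhs (scalar_kernel k2) Hk2"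
    and HK1: "rkhs K1 HK1"
    and HK: "rkhs K HK"
    and norm_preserving: "\<forall>\<psi>\<in>multipliers HK1.
          op_norm HK (mult_op (mult_tensor_id tens \<psi>)) = op_norm HK1 (mult_op \<psi>)"
    and dense: "dense_in (hcarrier Hk1 \<inter> hcarrier Hk2) Hk1"
    and \<phi>: "\<phi> \<in> multipliers HK1"
    and isometric: "isometry_on HK (mult_op (mult_tensor_id tens \<phi>))"
  shows "(\<forall>C \<in> UNIV // kernel_rel k1. \<exists>V. isometry V \<and> (\<forall>x\<in>C. \<phi> x = V)) \<and>
         ((\<forall>x y. k1 x y \<noteq> 0) \<longrightarrow>
            UNIV // kernel_rel k1 = {UNIV} \<and> (\<exists>V. isometry V \<and> (\<forall>x. \<phi> x = V)))"
proof -
  interpret T: hilbert_tensor_product tens by unfold_locales (rule tensor)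
  \<comment> \<open>Brings \<open>HK\<close> under the same locale as the scalar spaces and
    \<open>HK1\<close>.\<close>
  have K_eq: "K = times_id (\<lambda>x y. k1 x y * k2 x y)"
    unfolding K K1 K2 by (intro ext) (simp add: kernel_prod_def times_id_eq T.op_tensor_scaleC)
  interpret sc: rkhs_times_id k1 Hk1 by (rule rkhs_times_idI[OF Hk1])
  interpret k2: rkhs_times_id k2 Hk2 by (rule rkhs_times_idI[OF Hk2])
  interpret vec: rkhs_times_id k1 HK1 by (rule rkhs_times_idI[OF HK1[unfolded K1]])
  interpret P: rkhs_times_id "\<lambda>x y. k1 x y * k2 x y" HK
    by (rule rkhs_times_idI[OF HK[unfolded K_eq]])
  have column: "\<exists>x. k x l \<noteq> 0" if "nonvanishing (scalar_kernel k)"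
    for k :: "'l \<Rightarrow> 'l \<Rightarrow> complex" and l
  proof (rule ccontr)
    assume "\<not> ?thesis"
    hence "(\<lambda>x. scalar_kernel k x l) = 0"
      by (simp add: fun_eq_iff zero_fun_apply times_id_def)
    thus False using that by (simp add: nonvanishing_def)
  qed
  have diagonal: "k1 x x \<noteq> 0" "k2 x x \<noteq> 0" for x
    using column[OF kernel1(2), of x] column[OF kernel2(2), of x]
      sc.diagonal_nonzero[of 1 _ x] k2.diagonal_nonzero[of 1 _ x] by auto
  \<comment> \<open>If the second space were zero, all elementary tensors would vanish, by totality
    so would the whole tensor product, and \<open>K\<close> with it.\<close>
  have "\<exists>\<xi> :: 'b. \<xi> \<noteq> 0"
  proof (rule ccontr)
    assume "\<not> ?thesis"
    hence zero: "norm (b :: 'b) = 0" for b by simp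
    have "tens a b = 0" for a b
      using T.norm_tens[of a b] unfolding zero by simp
    hence "{tens a b | a b. True} = {0}" by simp
    hence "(UNIV :: 'c set) = {0}"
      using T.closure_span_tens by (simp add: complex_vector.span_insert_0)
    hence "\<zeta> = 0" for \<zeta> :: 'c by blast
    hence "(\<lambda>x. K x y) = 0" for y
      by (simp add: fun_eq_iff zero_fun_apply)
    thus False using K(2) by (simp add: nonvanishing_def)
  qed
  then obtain \<xi> :: 'b where \<xi>: "\<xi> \<noteq> 0" by blast
  \<comment> \<open>Norm preservation for \<open>\<phi>\<close> itself: an isometry on
    \<open>HK\<close> has operator norm at most 1.\<close>
  have "op_norm HK1 (mult_op \<phi>) \<le> 1"
    using norm_preserving \<phi> P.op_norm_isometry_le[OF isometric] by simp
  hence contractive: "hnorm HK1 (mult_op \<phi> f) \<le> hnorm HK1 f" if "f \<in> hcarrier HK1" for f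
    using vec.mult_op_le_op_norm[OF \<phi> that] mult_right_mono[OF _ vec.N_nonneg[OF that], of _ 1]
    by fastforce
  interpret isometric_multiplier k1 k2 HK1 Hk1 Hk2 HK tens \<phi> \<xi>
    by unfold_locales (use \<phi> contractive isometric dense \<xi> diagonal in auto)
  have class_eq: "\<phi> y = \<phi> x" if rel: "(x, y) \<in> kernel_rel k1" for x y
  proof -
    obtain m :: nat and s where s: "m \<ge> 1" "s 1 = x" "s m = y"
        "\<And>j. 1 \<le> j \<Longrightarrow> j \<le> m - 1 \<Longrightarrow> k1 (s j) (s (j + 1)) \<noteq> 0"
      using rel unfolding kernel_rel_def by blast
    have "\<phi> (s m) = \<phi> (s 1)"
      using s(1) s(4)
    proof (induction m rule: dec_induct)
      case (step j)
      have "\<phi> (s j) = \<phi> (s (j + 1))"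
        by (rule multiplier_eq, rule step.prems) (use step.hyps in simp_all)
      moreover have "\<phi> (s j) = \<phi> (s 1)"
        by (rule step.IH, rule step.prems) simp_all
      ultimately show ?case by simp
    qed simp
    thus ?thesis using s by simp
  qed
  have classes: "\<exists>V. isometry V \<and> (\<forall>x\<in>C. \<phi> x = V)" if C: "C \<in> UNIV // kernel_rel k1" for C
  proof -
    obtain x where "C = kernel_rel k1 `` {x}"
      using C by (auto simp: quotient_def)
    thus ?thesis using class_eq multiplier_isometry by blast
  qed
  moreover have "UNIV // kernel_rel k1 = {UNIV} \<and> (\<exists>V. isometry V \<and> (\<forall>x. \<phi> x = V))"
    if nonzero: "\<forall>x y. k1 x y \<noteq> 0"
  proof -
    have "(x, y) \<in> kernel_rel k1" for x y
      unfolding kernel_rel_def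
      \<comment> \<open>Chains are indexed from 1, so length 2 means the single link from
        \<open>x\<close> to \<open>y\<close>.\<close>
      using nonzero by (auto intro!: exI[of _ "2::nat"] exI[of _ "\<lambda>j. if j = 1 then x else y"])
    hence "kernel_rel k1 = UNIV" by auto
    hence "UNIV // kernel_rel k1 = {UNIV}" by (auto simp: quotient_def)
    thus ?thesis using classes[of UNIV] by auto
  qed
  ultimately show ?thesis by blast
qed

end
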